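(* Let $\mathcal{C}$ be a class of finite connected unlabelled graphs, the size of a graph being its number of vertices, whose generating series $C(x)=\sum_{k\ge1}c_kx^k$, $c_k=|\mathcal{C}_k|$, is subexponential, and let $m=\min\{k\in\mathbb{N}:c_k>0\}$. Let $\mathsf{C}_n$ be drawn uniformly at random from $\mathcal{C}_n$, and let $\mathsf{G}_{n,N}$ be drawn uniformly at random from the set $\mathcal{G}_{n,N}$ of unlabelled graphs with $n$ vertices and exactly $N$ connected components, all belonging to $\mathcal{C}$. Assume that $mN/n\to\lambda\in[0,1)$ as $n,N\to\infty$. If the sequence $(\mathsf{C}_n)_{n\ge1}$ converges to a limit object $(\mathbf{C},\mathbf{o})$ in the Benjamini–Schramm sense, then $\mathsf{G}_{n,N}$ converges as $n,N\to\infty$ in the Benjamini–Schramm sense to a limit object $(\mathbf{G},\mathbf{o})$ whose law is the mixture $$(1-\lambda)\,\delta_{(\mathbf{C},\mathbf{o})}+\lambda\,\delta_{(\mathsf{C}_m,o_m)},$$ where $o_m$ is a vertex chosen uniformly at random among the $m$ vertices of $\mathsf{C}_m$. In particular, if $N=o(n)$, then $(\mathbf{G},\mathbf{o})=(\mathbf{C},\mathbf{o})$ (in law).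
   Context: $\mathbb{N}=\{1,2,\dots\}$; $\mathcal{C}_n$ is the (finite) set of graphs in $\mathcal{C}$ with $n$ vertices. Elements of $\mathcal{G}_{n,N}$ are identified with multisets of $N$ elements (counted with multiplicity) of $\mathcal{C}$ of total size $n$. With $c_0=0$, $C(x)$ is called subexponential with radius of convergence $\rho>0$ if $c_n>0$ for all large $n$ and, as $n\to\infty$, $c_{n-1}/c_n\to\rho$ and $c_n^{-1}\sum_{1\le k\le n}c_kc_{n-k}\to2C(\rho)<\infty$ (for integer coefficients, as here, necessarily $\rho<1$). The random graph $\mathsf{C}_n$ is defined for those $n$ with $c_n>0$, in particular for $n=m$ and for all large $n$. Rooted graphs and Benjamini–Schramm convergence: a rooted graph $(G,o)$ is a connected locally finite simple graph $G$ with a distinguished vertex $o$. Two rooted graphs are isomorphic, $(G,o)\simeq(G',o')$, if there is a graph isomorphism between $G$ and $G'$ that maps $o$ to $o'$; $\mathcal{B}_*$ denotes the set of isomorphism classes. $B_k(G,o)$ is the subgraph (rooted at $o$) induced by all vertices within graph distance $k$ of $o$. A sequence of (possibly random) graphs $(\mathsf{H}_n)$ converges in the Benjamini–Schramm sense to a random element $(\mathbf{H},\mathbf{o})$ of $\mathcal{B}_*$ if, for $o_n$ a vertex of $\mathsf{H}_n$ selected uniformly at random, $$\lim_{n\to\infty}\Pr[B_k(\mathsf{H}_n,o_n)\simeq(G,o)]=\Pr[B_k(\mathbf{H},\mathbf{o})\simeq(G,o)]\quad\text{for all }k\in\mathbb{N},\ (G,o)\in\mathcal{B}_*.$$ If $\mathsf{H}_n$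 is not connected (as for $\mathsf{G}_{n,N}$), $(\mathsf{H}_n,o_n)$ stands for the connected component of $\mathsf{H}_n$ containing the uniformly chosen vertex $o_n$, rooted at $o_n$. In the mixture, $\delta_X$ for a random rooted graph $X$ denotes the law of $X$; that is, $(\mathbf{G},\mathbf{o})$ is distributed as $(\mathbf{C},\mathbf{o})$ with probability $1-\lambda$ and as $(\mathsf{C}_m,o_m)$ with probability $\lambda$. The limit "$n,N\to\infty$" is along any sequence of pairs $(n,N)\in\mathbb{N}^2$ with $n\to\infty$, $N\to\infty$ and $mN/n\to\lambda$. *)

theory Defs
  imports
    "HOL-Probability.Probability"
    "HOL-Library.Extended_Nat"
    "HOL-Library.Landau_Symbols"
begin

section \<open>Simple graphs\<close>

datatype 'a graph = Graph (verts: "'a set") (adj: "('a \<times> 'a) set")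

definition simple_graph :: "'a graph \<Rightarrow> bool" where
  "simple_graph G \<longleftrightarrow> adj G \<subseteq> verts G \<times> verts G \<and> sym (adj G) \<and> irrefl (adj G)"

definition connected_graph :: "'a graph \<Rightarrow> bool" where
  "connected_graph G \<longleftrightarrow> verts G \<noteq> {} \<and> (\<forall>u\<in>verts G. \<forall>v\<in>verts G. (u, v) \<in> (adj G)\<^sup>*)"

definition locally_finite :: "'a graph \<Rightarrow> bool" where
  "locally_finite G \<longleftrightarrow> (\<forall>v\<in>verts G. finite {u. (v, u) \<in> adj G})"

definition graph_isomorphism :: "('a \<Rightarrow> 'b) \<Rightarrow> 'a graph \<Rightarrow> 'b graph \<Rightarrow> bool" where
  "graph_isomorphism f G H \<longleftrightarrow> bij_betw f (verts G) (verts H) \<and>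
     (\<forall>u\<in>verts G. \<forall>v\<in>verts G. (u, v) \<in> adj G \<longleftrightarrow> (f u, f v) \<in> adj H)"

definition induced :: "'a graph \<Rightarrow> 'a set \<Rightarrow> 'a graph" where
  "induced G S = Graph (verts G \<inter> S) (adj G \<inter> S \<times> S)"

text \<open>Graph distance, infinite if there is no walk.\<close>

definition gdist :: "'a graph \<Rightarrow> 'a \<Rightarrow> 'a \<Rightarrow> enat" where
  "gdist G u v = (INF i\<in>{i. (u, v) \<in> adj G ^^ i}. enat i)"

definition ball_verts :: "nat \<Rightarrow> 'a graph \<Rightarrow> 'a \<Rightarrow> 'a set" where
  "ball_verts k G r = {v \<in> verts G. gdist G r v \<le> enat k}"

definition component_verts :: "'a graph \<Rightarrow> 'a \<Rightarrow> 'a set" where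
  "component_verts G r = {v \<in> verts G. (r, v) \<in> (adj G)\<^sup>*}"

definition components :: "'a graph \<Rightarrow> 'a set set" where
  "components G = component_verts G ` verts G"

definition finite_graph :: "'a graph \<Rightarrow> bool" where
  "finite_graph G \<longleftrightarrow> simple_graph G \<and> finite (verts G) \<and> verts G \<noteq> {}"

definition rooted_graph :: "'a graph \<times> 'a \<Rightarrow> bool" where
  "rooted_graph = (\<lambda>(G, r). simple_graph G \<and> connected_graph G \<and> locally_finite G \<and> r \<in> verts G)"

definition iso_finite :: "'a graph \<Rightarrow> 'a graph \<Rightarrow> bool" where
  "iso_finite G H \<longleftrightarrow> finite_graph G \<and> finite_graph H \<and> (\<exists>f. graph_isomorphism f G H)"

definition iso_rooted :: "'a graph \<times> 'a \<Rightarrow> 'a graph \<times> 'a \<Rightarrow> bool" where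
  "iso_rooted = (\<lambda>(G, r) (H, s). rooted_graph (G, r) \<and> rooted_graph (H, s) \<and>
     (\<exists>f. graph_isomorphism f G H \<and> f r = s))"

lemma graph_isomorphism_id: "graph_isomorphism (\<lambda>x. x) G G"
  by (auto simp: graph_isomorphism_def bij_betw_def)

lemma graph_isomorphism_comp:
  assumes "graph_isomorphism f G H" "graph_isomorphism g H K"
  shows "graph_isomorphism (\<lambda>x. g (f x)) G K"
proof -
  have "f u \<in> verts H" if "u \<in> verts G" for u
    using assms that by (auto simp: graph_isomorphism_def bij_betw_def)
  then show ?thesis
    using assms bij_betw_trans[of f "verts G" "verts H" g "verts K"]
    by (simp add: graph_isomorphism_def comp_def)
qed

lemma graph_isomorphism_inv:
  assumes "graph_isomorphism f G H"
  shows "graph_isomorphism (inv_into (verts G) f) H G"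
proof -
  have b: "bij_betw f (verts G) (verts H)"
    using assms by (simp add: graph_isomorphism_def)
  have "inv_into (verts G) f u \<in> verts G \<and> f (inv_into (verts G) f u) = u" if "u \<in> verts H" for u
    using b that by (metis bij_betw_imp_surj_on f_inv_into_f inv_into_into)
  then show ?thesis
    using assms bij_betw_inv_into[OF b] by (simp add: graph_isomorphism_def)
qed

lemma relpow_in_verts:
  assumes "simple_graph G" "u \<in> verts G" "(u, v) \<in> adj G ^^ i"
  shows "v \<in> verts G"
  using assms by (induction i arbitrary: v) (auto simp: simple_graph_def)

lemma graph_isomorphism_relpow:
  assumes iso: "graph_isomorphism f G H" and G: "simple_graph G"
    and "u \<in> verts G" "(u, v) \<in> adj G ^^ i"
  shows "(f u, f v) \<in> adj H ^^ i"
  using assms(3,4)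
proof (induction i arbitrary: v)
  case (Suc i)
  then obtain w where w: "(u, w) \<in> adj G ^^ i" "(w, v) \<in> adj G" by auto
  then have "w \<in> verts G" "v \<in> verts G"
    using G by (auto simp: simple_graph_def)
  then have "(f w, f v) \<in> adj H"
    using iso w by (auto simp: graph_isomorphism_def)
  then show ?case using Suc w by auto
qed auto

lemma graph_isomorphism_relpow_iff:
  assumes iso: "graph_isomorphism f G H" and G: "simple_graph G" and H: "simple_graph H"
    and u: "u \<in> verts G" and v: "v \<in> verts G"
  shows "(f u, f v) \<in> adj H ^^ i \<longleftrightarrow> (u, v) \<in> adj G ^^ i"
proof
  let ?g = "inv_into (verts G) f"
  have b: "bij_betw f (verts G) (verts H)"
    using iso by (simp add: graph_isomorphism_def)
  assume "(f u, f v) \<in> adj H ^^ i"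
  then have "(?g (f u), ?g (f v)) \<in> adj G ^^ i"
    using graph_isomorphism_relpow[OF graph_isomorphism_inv[OF iso] H, of "f u" "f v" i] b u
    by (auto simp: bij_betw_def simp del: inv_into_f_f)
  then show "(u, v) \<in> adj G ^^ i"
    using b u v by (simp add: bij_betw_def)
qed (rule graph_isomorphism_relpow[OF iso G u])

lemma graph_isomorphism_ball_verts:
  assumes "graph_isomorphism f G H" "simple_graph G" "simple_graph H" "r \<in> verts G"
  shows "ball_verts k H (f r) = f ` ball_verts k G r"
proof -
  have "verts H = f ` verts G"
    using assms by (auto simp: graph_isomorphism_def bij_betw_def)
  moreover have "gdist H (f r) (f v) = gdist G r v" if "v \<in> verts G" for v
    using graph_isomorphism_relpow_iff[OF assms that] by (simp add: gdist_def)
  ultimately show ?thesis by (auto simp: ball_verts_def)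
qed

lemma graph_isomorphism_component_verts:
  assumes "graph_isomorphism f G H" "simple_graph G" "simple_graph H" "r \<in> verts G"
  shows "component_verts H (f r) = f ` component_verts G r"
proof -
  have "verts H = f ` verts G"
    using assms by (auto simp: graph_isomorphism_def bij_betw_def)
  moreover have "(f r, f v) \<in> (adj H)\<^sup>* \<longleftrightarrow> (r, v) \<in> (adj G)\<^sup>*" if "v \<in> verts G" for v
    using graph_isomorphism_relpow_iff[OF assms that] by (simp add: rtrancl_power)
  ultimately show ?thesis by (auto simp: component_verts_def)
qed

lemma graph_isomorphism_induced:
  assumes "graph_isomorphism f G H" "S \<subseteq> verts G"
  shows "graph_isomorphism f (induced G S) (induced H (f ` S))"
proof -
  have S: "verts G \<inter> S = S" "verts H \<inter> f ` S = f ` S"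
    using assms by (auto simp: graph_isomorphism_def bij_betw_def)
  have "inj_on f S"
    using assms by (auto simp: graph_isomorphism_def bij_betw_def intro: inj_on_subset)
  then show ?thesis
    using assms unfolding graph_isomorphism_def induced_def
    by (auto simp: S bij_betw_def subset_iff)
qed

lemma simple_graph_induced: "simple_graph G \<Longrightarrow> simple_graph (induced G S)"
  by (auto simp: simple_graph_def induced_def sym_def irrefl_def)

lemma locally_finite_induced: "locally_finite G \<Longrightarrow> locally_finite (induced G S)"
  unfolding locally_finite_def induced_def
  by (auto intro: finite_subset[rotated])

lemma connected_induced:
  assumes "simple_graph G" "r \<in> S" "S \<subseteq> verts G"
    and "\<And>v. v \<in> S \<Longrightarrow> (r, v) \<in> (adj G \<inter> S \<times> S)\<^sup>*"
  shows "connected_graph (induced G S)"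
proof -
  have "sym ((adj G \<inter> S \<times> S)\<^sup>*)"
    using assms(1) by (intro sym_rtrancl) (auto simp: simple_graph_def sym_def)
  then have "(u, v) \<in> (adj G \<inter> S \<times> S)\<^sup>*" if "u \<in> S" "v \<in> S" for u v
    using assms(4)[OF that(1)] assms(4)[OF that(2)] by (meson rtrancl_trans symD)
  then show ?thesis
    using assms(2,3) by (auto simp: connected_graph_def induced_def)
qed

lemma gdist_le_iff: "gdist G u v \<le> enat k \<longleftrightarrow> (\<exists>i\<le>k. (u, v) \<in> adj G ^^ i)"
proof
  assume le: "gdist G u v \<le> enat k"
  let ?A = "{i. (u, v) \<in> adj G ^^ i}"
  have ne: "?A \<noteq> {}"
  proof
    assume "?A = {}"
    then have "gdist G u v = top" unfolding gdist_def by simp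
    then show False using le by (simp add: top_enat_def)
  qed
  then have "gdist G u v \<in> enat ` ?A"
    unfolding gdist_def by (metis (no_types, lifting) Inf_enat_def LeastI_ex empty_is_image ex_in_conv)
  then show "\<exists>i\<le>k. (u, v) \<in> adj G ^^ i" using le by auto
next
  assume "\<exists>i\<le>k. (u, v) \<in> adj G ^^ i"
  then obtain i where "i \<le> k" "(u, v) \<in> adj G ^^ i" by auto
  then have "gdist G u v \<le> enat i"
    unfolding gdist_def by (intro INF_lower) auto
  then show "gdist G u v \<le> enat k"
    using \<open>i \<le> k\<close> by (meson enat_ord_simps(1) order_trans)
qed

lemma rooted_graph_ball:
  assumes "rooted_graph (G, r)"
  shows "rooted_graph (induced G (ball_verts k G r), r)"
proof -
  let ?S = "ball_verts k G r"
  have G: "simple_graph G" and r: "r \<in> verts G" and lf: "locally_finite G"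
    using assms by (auto simp: rooted_graph_def)
  have rS: "r \<in> ?S"
    using r by (auto simp: ball_verts_def gdist_le_iff intro!: exI[of _ 0])
  have walk: "(r, v) \<in> (adj G \<inter> ?S \<times> ?S)\<^sup>*" if "(r, v) \<in> adj G ^^ i" "i \<le> k" for v i
    using that
  proof (induction i arbitrary: v)
    case (Suc i)
    then obtain w where w: "(r, w) \<in> adj G ^^ i" "(w, v) \<in> adj G" by auto
    have "w \<in> verts G" "v \<in> verts G"
      using w Suc.prems relpow_in_verts[OF G r] by blast+
    then have "w \<in> ?S" "v \<in> ?S"
      unfolding ball_verts_def gdist_le_iff mem_Collect_eq
      using w(1) Suc.prems Suc_leD by blast+
    then show ?case
      using Suc w by (auto intro: rtrancl_into_rtrancl)
  qed auto
  have "connected_graph (induced G ?S)"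
  proof (rule connected_induced[OF G rS])
    fix v assume "v \<in> ?S"
    then show "(r, v) \<in> (adj G \<inter> ?S \<times> ?S)\<^sup>*"
      using walk by (auto simp: ball_verts_def gdist_le_iff)
  qed (auto simp: ball_verts_def)
  then show ?thesis
    using simple_graph_induced[OF G] locally_finite_induced[OF lf] rS r
    by (auto simp: rooted_graph_def induced_def)
qed

lemma rooted_graph_component:
  assumes "finite_graph G" "r \<in> verts G"
  shows "rooted_graph (induced G (component_verts G r), r)"
proof -
  let ?S = "component_verts G r"
  have G: "simple_graph G" and fin: "finite (verts G)"
    using assms by (auto simp: finite_graph_def)
  have rS: "r \<in> ?S"
    using assms by (auto simp: component_verts_def)
  have walk: "(r, v) \<in> (adj G \<inter> ?S \<times> ?S)\<^sup>*" if "(r, v) \<in> (adj G)\<^sup>*" for v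
    using that
  proof (induction rule: rtrancl_induct)
    case (step w v)
    have "w \<in> ?S" "v \<in> ?S"
      using step.hyps G by (auto simp: component_verts_def simple_graph_def)
    then show ?case using step by (auto intro: rtrancl_into_rtrancl)
  qed auto
  have "connected_graph (induced G ?S)"
    by (rule connected_induced[OF G rS]) (auto simp: component_verts_def walk[unfolded component_verts_def])
  moreover have "locally_finite G"
    unfolding locally_finite_def using G fin
    by (auto simp: simple_graph_def intro: finite_subset[OF _ fin])
  ultimately show ?thesis
    using simple_graph_induced[OF G] locally_finite_induced rS assms
    by (auto simp: rooted_graph_def induced_def)
qed

lemma part_equivp_iso_finite: "part_equivp (iso_finite :: 'a graph \<Rightarrow> 'a graph \<Rightarrow> bool)"
proof (rule part_equivpI)
  let ?G = "Graph {undefined} {} :: 'a graph"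
  have "iso_finite ?G ?G"
    using graph_isomorphism_id[of ?G]
    by (auto simp: iso_finite_def finite_graph_def simple_graph_def)
  then show "\<exists>x. iso_finite x (x :: 'a graph)" by blast
  show "symp (iso_finite :: 'a graph \<Rightarrow> _)"
    by (auto simp: symp_def iso_finite_def intro: graph_isomorphism_inv)
  show "transp (iso_finite :: 'a graph \<Rightarrow> _)"
    by (auto simp: transp_def iso_finite_def intro: graph_isomorphism_comp)
qed

lemma part_equivp_iso_rooted: "part_equivp (iso_rooted :: 'a graph \<times> 'a \<Rightarrow> 'a graph \<times> 'a \<Rightarrow> bool)"
proof (rule part_equivpI)
  let ?G = "Graph {undefined} {} :: 'a graph"
  have "iso_rooted (?G, undefined) (?G, undefined)"
    using graph_isomorphism_id[of ?G]
    by (auto simp: iso_rooted_def rooted_graph_def simple_graph_def connected_graph_def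
        locally_finite_def)
  then show "\<exists>x. iso_rooted x (x :: 'a graph \<times> 'a)" by blast
  show "symp (iso_rooted :: 'a graph \<times> 'a \<Rightarrow> _)"
  proof (rule sympI)
    fix x y :: "'a graph \<times> 'a"
    assume "iso_rooted x y"
    then obtain G r H s f where
      *: "x = (G, r)" "y = (H, s)" "graph_isomorphism f G H" "f r = s"
        "rooted_graph (G, r)" "rooted_graph (H, s)"
      by (cases x; cases y) (auto simp: iso_rooted_def)
    then have "inv_into (verts G) f s = r"
      by (auto simp: rooted_graph_def graph_isomorphism_def bij_betw_def)
    then show "iso_rooted y x"
      using * graph_isomorphism_inv[OF *(3)] by (auto simp: iso_rooted_def)
  qed
  show "transp (iso_rooted :: 'a graph \<times> 'a \<Rightarrow> _)"
    by (fastforce simp: transp_def iso_rooted_def intro: graph_isomorphism_comp)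
qed

section \<open>Unlabelled graphs and rooted graphs up to isomorphism\<close>

text \<open>
  Finite graphs, and locally finite connected graphs, have at most countably many vertices;
  hence vertices in \<open>nat\<close> represent every isomorphism class.  Unlabelled graphs are nonempty.
\<close>

quotient_type ugraph = "nat graph" / partial: iso_finite
  by (rule part_equivp_iso_finite)

quotient_type rgraph = "nat graph \<times> nat" / partial: iso_rooted
  by (rule part_equivp_iso_rooted)

lift_definition usize :: "ugraph \<Rightarrow> nat" is "\<lambda>G. card (verts G)"
  by (auto simp: iso_finite_def graph_isomorphism_def intro: bij_betw_same_card)

lift_definition uconnected :: "ugraph \<Rightarrow> bool" is connected_graph
proof -
  have "connected_graph H"
    if GH: "iso_finite G H" and "connected_graph G" for G H :: "nat graph"
  proof -
    obtain f where f: "graph_isomorphism f G H" and G: "simple_graph G" and H: "simple_graph H"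
      using GH by (auto simp: iso_finite_def finite_graph_def)
    have "verts H = f ` verts G"
      using f by (auto simp: graph_isomorphism_def bij_betw_def)
    moreover have "(f u, f v) \<in> (adj H)\<^sup>*" if "u \<in> verts G" "v \<in> verts G" for u v
      using graph_isomorphism_relpow_iff[OF f G H that] \<open>connected_graph G\<close> that
      by (auto simp: connected_graph_def rtrancl_power)
    ultimately show ?thesis
      using \<open>connected_graph G\<close> by (auto simp: connected_graph_def)
  qed
  moreover have "iso_finite H G" if "iso_finite G H" for G H :: "nat graph"
    using that part_equivp_iso_finite by (metis part_equivp_symp)
  ultimately show "\<And>G H :: nat graph. iso_finite G H \<Longrightarrow> connected_graph G = connected_graph H"
    by blast
qed

text \<open>The connected components of an unlabelled graph, each up to isomorphism, with multiplicity.\<close>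

lift_definition ucomponents :: "ugraph \<Rightarrow> ugraph multiset" is
  "\<lambda>G. image_mset (\<lambda>S. abs_ugraph (induced G S)) (mset_set (components G))"
proof -
  fix G H :: "nat graph"
  assume GH: "iso_finite G H"
  then obtain f where f: "graph_isomorphism f G H" and G: "simple_graph G" and H: "simple_graph H"
    and fin: "finite_graph G" "finite_graph H"
    by (auto simp: iso_finite_def finite_graph_def)
  have vH: "verts H = f ` verts G" and inj: "inj_on f (verts G)"
    using f by (auto simp: graph_isomorphism_def bij_betw_def)
  have sub: "S \<subseteq> verts G \<and> S \<noteq> {}" if "S \<in> components G" for S
    using that by (auto simp: components_def component_verts_def)
  have comps: "components H = (`) f ` components G"
    unfolding components_def vH image_image
    by (intro image_cong refl graph_isomorphism_component_verts[OF f G H])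
  have "inj_on ((`) f) (components G)"
    using sub inj by (intro inj_onI) (metis inj_on_image_eq_iff)
  then have "mset_set (components H) = image_mset ((`) f) (mset_set (components G))"
    by (simp add: comps image_mset_mset_set)
  moreover have "abs_ugraph (induced G S) = abs_ugraph (induced H (f ` S))"
    if S: "S \<in> components G" for S
  proof -
    have "iso_finite (induced G S) (induced H (f ` S))"
      unfolding iso_finite_def
    proof (intro conjI exI)
      show "finite_graph (induced G S)"
        using fin(1) sub[OF S] simple_graph_induced[OF G, of S]
        by (auto simp: finite_graph_def induced_def)
      show "finite_graph (induced H (f ` S))"
        using fin(2) sub[OF S] simple_graph_induced[OF H, of "f ` S"]
        by (auto simp: finite_graph_def induced_def vH)
      show "graph_isomorphism f (induced G S) (induced H (f ` S))"
        using graph_isomorphism_induced[OF f] sub[OF S] by blast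
    qed
    then show ?thesis
      by (metis Quotient_ugraph Quotient_rel_abs)
  qed
  moreover have "finite (components G)"
    using fin by (auto simp: components_def finite_graph_def)
  ultimately show "image_mset (\<lambda>S. abs_ugraph (induced G S)) (mset_set (components G)) =
      image_mset (\<lambda>S. abs_ugraph (induced H S)) (mset_set (components H))"
    by (auto simp: multiset.map_comp comp_def intro!: image_mset_cong)
qed

lift_definition rball :: "nat \<Rightarrow> rgraph \<Rightarrow> rgraph" is
  "\<lambda>k (G, r). (induced G (ball_verts k G r), r)"
proof -
  fix k :: nat and x y :: "nat graph \<times> nat"
  assume xy: "iso_rooted x y"
  then obtain G r H s f where
    *: "x = (G, r)" "y = (H, s)" "graph_isomorphism f G H" "f r = s"
      "rooted_graph (G, r)" "rooted_graph (H, s)"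
    by (cases x; cases y) (auto simp: iso_rooted_def)
  have "ball_verts k H s = f ` ball_verts k G r"
    using * graph_isomorphism_ball_verts[of f G H r k] by (auto simp: rooted_graph_def)
  moreover have "ball_verts k G r \<subseteq> verts G"
    by (auto simp: ball_verts_def)
  ultimately have "graph_isomorphism f (induced G (ball_verts k G r)) (induced H (ball_verts k H s))"
    using graph_isomorphism_induced[OF *(3)] by metis
  then show "iso_rooted (case x of (G, r) \<Rightarrow> (induced G (ball_verts k G r), r))
      (case y of (G, r) \<Rightarrow> (induced G (ball_verts k G r), r))"
    using * rooted_graph_ball by (auto simp: iso_rooted_def)
qed

text \<open>The law of the component of a uniformly random vertex, rooted at that vertex.\<close>

lift_definition uniform_rooting :: "ugraph \<Rightarrow> rgraph pmf" is
  "\<lambda>G. map_pmf (\<lambda>v. abs_rgraph (induced G (component_verts G v), v)) (pmf_of_set (verts G))"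
proof -
  fix G H :: "nat graph"
  assume "iso_finite G H"
  then obtain f where f: "graph_isomorphism f G H" and G: "simple_graph G" and H: "simple_graph H"
    and fin: "finite_graph G" "finite_graph H"
    by (auto simp: iso_finite_def finite_graph_def)
  have b: "bij_betw f (verts G) (verts H)"
    using f by (auto simp: graph_isomorphism_def)
  have finV: "finite (verts G)" "verts G \<noteq> {}"
    using fin by (auto simp: finite_graph_def)
  have "abs_rgraph (induced G (component_verts G v), v) =
      abs_rgraph (induced H (component_verts H (f v)), f v)" if v: "v \<in> verts G" for v
  proof -
    have fv: "f v \<in> verts H" using b v by (auto simp: bij_betw_def)
    have "component_verts G v \<subseteq> verts G" by (auto simp: component_verts_def)
    then have "graph_isomorphism f (induced G (component_verts G v)) (induced H (component_verts H (f v)))"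
      using graph_isomorphism_induced[OF f] graph_isomorphism_component_verts[OF f G H v] by metis
    then have "iso_rooted (induced G (component_verts G v), v) (induced H (component_verts H (f v)), f v)"
      using rooted_graph_component[OF fin(1) v] rooted_graph_component[OF fin(2) fv]
      by (auto simp: iso_rooted_def)
    then show ?thesis
      by (metis Quotient_rgraph Quotient_rel_abs)
  qed
  moreover have "pmf_of_set (verts H) = map_pmf f (pmf_of_set (verts G))"
    using map_pmf_of_set_bij_betw[OF b] finV by simp
  ultimately show "map_pmf (\<lambda>v. abs_rgraph (induced G (component_verts G v), v)) (pmf_of_set (verts G)) =
      map_pmf (\<lambda>v. abs_rgraph (induced H (component_verts H v), v)) (pmf_of_set (verts H))"
    using finV by (simp add: pmf.map_comp comp_def) (rule map_pmf_cong, auto)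
qed

section \<open>Benjamini--Schramm convergence\<close>

text \<open>
  The Borel sets of the local topology on rooted graphs: there are only countably many possible
  values of \<open>rball k\<close>, and its fibres form a base of the topology.
\<close>

definition rgraph_space :: "rgraph measure" where
  "rgraph_space = sigma UNIV {{g. rball k g = b} | k b. True}"

definition rgraph_law :: "rgraph pmf \<Rightarrow> rgraph measure" where
  "rgraph_law p = distr (measure_pmf p) rgraph_space (\<lambda>g. g)"

text \<open>
  The law of \<open>(H, o)\<close>, with \<open>H\<close> uniform in a finite nonempty set \<open>A\<close> of unlabelled graphs and
  \<open>o\<close> a uniform vertex of \<open>H\<close>.
\<close>

definition random_rooted :: "ugraph set \<Rightarrow> rgraph pmf" where
  "random_rooted A = bind_pmf (pmf_of_set A) uniform_rooting"

definition BS_converges :: "(nat \<Rightarrow> rgraph pmf) \<Rightarrow> rgraph measure \<Rightarrow> bool" where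
  "BS_converges P \<mu> \<longleftrightarrow> \<mu> \<in> space (prob_algebra rgraph_space) \<and>
     (\<forall>k\<ge>1. \<forall>b. (\<lambda>i. measure_pmf.prob (P i) {g. rball k g = b})
                  \<longlonglongrightarrow> measure \<mu> {g. rball k g = b})"

definition mixture :: "real \<Rightarrow> 'a measure \<Rightarrow> 'a measure \<Rightarrow> 'a measure" where
  "mixture p \<mu> \<nu> = Giry_Monad.bind (measure_pmf (bernoulli_pmf p)) (\<lambda>b. if b then \<nu> else \<mu>)"

section \<open>Graph classes\<close>

definition of_size :: "ugraph set \<Rightarrow> nat \<Rightarrow> ugraph set" where
  "of_size \<C> n = {G \<in> \<C>. usize G = n}"

definition with_components :: "ugraph set \<Rightarrow> nat \<Rightarrow> nat \<Rightarrow> ugraph set" where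
  "with_components \<C> n N =
     {G. usize G = n \<and> size (ucomponents G) = N \<and> set_mset (ucomponents G) \<subseteq> \<C>}"

definition subexponential :: "(nat \<Rightarrow> real) \<Rightarrow> real \<Rightarrow> bool" where
  "subexponential c \<rho> \<longleftrightarrow> \<rho> > 0 \<and> c 0 = 0 \<and> (\<forall>\<^sub>F n in sequentially. c n > 0) \<and>
     (\<lambda>n. c (n - 1) / c n) \<longlonglongrightarrow> \<rho> \<and>
     summable (\<lambda>k. c k * \<rho> ^ k) \<and>
     (\<lambda>n. (\<Sum>k=1..n. c k * c (n - k)) / c n) \<longlonglongrightarrow> 2 * (\<Sum>k. c k * \<rho> ^ k)"

end

(*
  Subtracting m from every component size turns a multiset of N components of total size n into
  N - l minimal components and a core of l larger ones with total excess s = n - m N, where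
  s / n tends to 1 - lambda.  Removing copies of one member from a multiset gives a recursive
  inequality s h(s) <= sum_k (k d(k) + ...) h(s - k) for the number h(s) of cores, d(k) being the
  number of graphs of excess k.  Subexponentiality of d turns it into h = O(d) and shows that
  almost every core consists of a single giant and a remainder of bounded excess; removing
  several copies at once costs nothing because rho < 1.  Given the remainder, the giant is uniform
  among the graphs of its size, which tends to infinity, and by symmetry a vertex in the minimal
  part sees a uniform minimal graph.
*)
theory Submission
  imports Defs
begin

section \<open>Subexponential sequences\<close>

text \<open>Benjamini-Schramm convergence is tested on one event A of rooted graphs at a time. The
  number of vertices of U times the probability that its uniform root falls in A is additive over
  components, so the task is to average an additive statistic over a uniform multiset. The obstacle
  is that cores do not carry equal weight: one with l members leaves a choice of N - l minimal
  components. These weights are compared only crudely. A core without a giant has at most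
  \<open>fillings N\<close> completions, and one more slot costs at most a factor
  \<open>card minimal\<close>; the cores made of a single giant already contribute
  \<open>card (level s) * fillings (N - 1)\<close>. So it suffices that the cores without a giant
  number at most \<epsilon> / \<open>card minimal\<close> times d(s), counted without the
  restriction l \<le> N. Only upper bounds for d enter that count, so d is replaced by a positive
  majorant that eventually agrees with it. The bound K on the remainder depends on \<epsilon> alone;
  hence finitely many remainders are involved, and a separate limit for each one suffices.\<close>

lemma shift_ratio_tendsto:
  fixes b :: "nat \<Rightarrow> real"
  assumes nz: "\<forall>\<^sub>F k in sequentially. b k \<noteq> 0"
    and ratio: "(\<lambda>k. b (k - 1) / b k) \<longlonglongrightarrow> \<rho>"
  shows "(\<lambda>s. b (s - r) / b s) \<longlonglongrightarrow> \<rho> ^ r"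
proof (induction r)
  case 0
  have "\<forall>\<^sub>F s in sequentially. b (s - 0) / b s = 1"
    using nz by eventually_elim auto
  then show ?case by (simp add: tendsto_eventually)
next
  case (Suc r)
  have f: "filterlim (\<lambda>s. s - r) sequentially sequentially"
    by (rule filterlim_minus_const_nat_at_top)
  have 1: "(\<lambda>s. b (s - r - 1) / b (s - r)) \<longlonglongrightarrow> \<rho>"
    by (rule filterlim_compose[OF ratio f])
  have 2: "\<forall>\<^sub>F s in sequentially. b (s - r) \<noteq> 0"
    using filterlim_iff[THEN iffD1, OF f] nz by blast
  have "(\<lambda>s. b (s - r - 1) / b (s - r) * (b (s - r) / b s)) \<longlonglongrightarrow> \<rho> * \<rho> ^ r"
    by (intro tendsto_mult 1 Suc)
  moreover have "\<forall>\<^sub>F s in sequentially.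
      b (s - r - 1) / b (s - r) * (b (s - r) / b s) = b (s - Suc r) / b s"
    using 2 by eventually_elim auto
  ultimately show ?case
    by (auto simp: filterlim_cong elim!: Lim_transform_eventually)
qed

text \<open>With S the value of the series at \<rho>, the whole convolution is eventually below
  \<open>(2 * S + \<epsilon> / 4) * c n\<close>, while each of its two ends exceeds
  \<open>(S - \<epsilon> / 4) * c n\<close>; at most 3/4 of \<open>\<epsilon> * c n\<close> remains
  for the middle. The bound holds for every K from some K0 on, so that K can later be
  enlarged.\<close>

lemma subexponential_middle_sum:
  fixes c :: "nat \<Rightarrow> real"
  assumes sub: "subexponential c \<rho>" and nonneg: "\<And>k. 0 \<le> c k" and "\<epsilon> > 0"
  obtains K0 where "\<And>K. K0 \<le> K \<Longrightarrow>
    \<forall>\<^sub>F n in sequentially. (\<Sum>k\<in>{K<..<n-K}. c k * c (n - k)) \<le> \<epsilon> * c n"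
proof -
  note S = sub[unfolded subexponential_def]
  let ?S = "\<Sum>k. c k * \<rho> ^ k"
  have pos: "\<forall>\<^sub>F n in sequentially. c n > 0" and c0: "c 0 = 0" using S by auto
  have shift: "(\<lambda>s. c (s - r) / c s) \<longlonglongrightarrow> \<rho> ^ r" for r
    using S by (intro shift_ratio_tendsto) (auto elim: eventually_mono)
  have "(\<lambda>K. \<Sum>k<K. c k * \<rho> ^ k) \<longlonglongrightarrow> ?S"
    using S summable_LIMSEQ by blast
  then have "\<forall>\<^sub>F K in sequentially. (\<Sum>k<K. c k * \<rho> ^ k) > ?S - \<epsilon> / 4"
    using \<open>\<epsilon> > 0\<close> by (intro order_tendstoD) auto
  then obtain K0 where K0: "\<And>K. K \<ge> K0 \<Longrightarrow> (\<Sum>k<K. c k * \<rho> ^ k) > ?S - \<epsilon> / 4"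
    unfolding eventually_sequentially by blast
  show thesis
  proof (rule that)
    fix K assume "K0 \<le> K"
    let ?E = "\<lambda>n. \<Sum>k\<le>K. c k * (c (n - k) / c n)"
    have "?E \<longlonglongrightarrow> (\<Sum>k\<le>K. c k * \<rho> ^ k)"
      by (intro tendsto_intros shift)
    moreover have "(\<Sum>k\<le>K. c k * \<rho> ^ k) > ?S - \<epsilon> / 4"
      using K0[of "Suc K"] \<open>K0 \<le> K\<close> by (simp add: lessThan_Suc_atMost)
    ultimately have E: "\<forall>\<^sub>F n in sequentially. ?E n > ?S - \<epsilon> / 4"
      by (rule order_tendstoD)
    have "(\<lambda>n. (\<Sum>k=1..n. c k * c (n - k)) / c n) \<longlonglongrightarrow> 2 * ?S"
      using S by blast
    then have T: "\<forall>\<^sub>F n in sequentially. (\<Sum>k=1..n. c k * c (n - k)) / c n < 2 * ?S + \<epsilon> / 4"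
      using \<open>\<epsilon> > 0\<close> by (intro order_tendstoD) auto
    show "\<forall>\<^sub>F n in sequentially. (\<Sum>k\<in>{K<..<n-K}. c k * c (n - k)) \<le> \<epsilon> * c n"
      using E T pos eventually_gt_at_top[of "2 * K"]
    proof eventually_elim
      case (elim n)
      let ?t = "\<lambda>k. c k * c (n - k)"
      have e: "sum ?t {..K} = ?E n * c n"
        using elim by (simp add: sum_distrib_right)
      have "sum ?t {n - K..n} = sum ?t {..K}"
        using elim
        by (intro sum.reindex_bij_witness[of _ "\<lambda>k. n - k" "\<lambda>k. n - k"]) auto
      moreover have "sum ?t {..n} = sum ?t {..K} + sum ?t {K<..<n-K} + sum ?t {n - K..n}"
      proof -
        have "{..n} = ({..K} \<union> {K<..<n-K}) \<union> {n - K..n}" using elim by auto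
        then show ?thesis
          using elim by (auto simp: sum.union_disjoint[symmetric] intro!: sum.union_disjoint
              trans[OF sum.union_disjoint])
      qed
      moreover have "sum ?t {..n} = sum ?t {1..n}"
        using c0 by (intro sum.mono_neutral_right) (auto simp: not_le)
      moreover have "sum ?t {1..n} < (2 * ?S + \<epsilon> / 4) * c n"
        using elim by (simp add: field_simps)
      moreover have "?E n * c n > (?S - \<epsilon> / 4) * c n"
        using elim by (intro mult_strict_right_mono)
      ultimately have "sum ?t {K<..<n-K} \<le> (2 * ?S + \<epsilon> / 4) * c n - 2 * ((?S - \<epsilon> / 4) * c n)"
        using e by linarith
      also have "\<dots> \<le> \<epsilon> * c n"
        using \<open>\<epsilon> > 0\<close> elim by (simp add: algebra_simps)
      finally show ?case .
    qed
  qed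
qed

text \<open>Positivity at every index permits division by \<open>b\<close>. Subexponentiality is
  stated through \<open>middle\<close>, without the value of the series, and so is stable under a
  shift of the index and under finitely many changes.\<close>

locale subexponential_weights =
  fixes b :: "nat \<Rightarrow> real" and \<rho> :: real
  assumes pos: "\<And>k. 0 < b k"
    and rho: "0 < \<rho>" "\<rho> < 1"
    and ratio: "(\<lambda>k. b (k - 1) / b k) \<longlonglongrightarrow> \<rho>"
    and middle: "\<And>\<epsilon>. 0 < \<epsilon> \<Longrightarrow> \<exists>K. \<forall>\<^sub>F s in sequentially.
           (\<Sum>k\<in>{K<..<s-K}. b k * b (s - k)) \<le> \<epsilon> * b s"
begin

section \<open>Convolution estimates for positive subexponential weights\<close>

lemma nonneg: "0 \<le> b k"
  using pos[of k] by simp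

lemma end_sum_bounded:
  obtains E where "0 < E" "\<forall>\<^sub>F s in sequentially. (\<Sum>k\<le>K. b k * b (s - k)) \<le> E * b s"
proof -
  let ?L = "\<Sum>k\<le>K. b k * \<rho> ^ k"
  have "(\<lambda>s. \<Sum>k\<le>K. b k * (b (s - k) / b s)) \<longlonglongrightarrow> ?L"
    using pos by (intro tendsto_intros shift_ratio_tendsto ratio always_eventually allI)
      (simp add: less_imp_neq[THEN not_sym])
  then have "\<forall>\<^sub>F s in sequentially. (\<Sum>k\<le>K. b k * (b (s - k) / b s)) < ?L + 1"
    by (rule order_tendstoD) simp
  then have "\<forall>\<^sub>F s in sequentially. (\<Sum>k\<le>K. b k * b (s - k)) \<le> (?L + 1) * b s"
  proof eventually_elim
    case (elim s)
    have "(\<Sum>k\<le>K. b k * b (s - k)) = (\<Sum>k\<le>K. b k * (b (s - k) / b s)) * b s"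
      using pos[of s] by (simp add: sum_distrib_right)
    then show ?case
      using elim nonneg by (simp add: mult_right_mono)
  qed
  moreover have "?L + 1 > 0"
    using nonneg rho by (intro add_nonneg_pos sum_nonneg) auto
  ultimately show thesis using that by blast
qed

text \<open>As \<rho> < 1, the weights eventually grow at least geometrically, so the values up to
  k/2 are negligible against \<open>b k\<close>. This makes the removal of two or more copies of one
  member harmless.\<close>

lemma half_sum_small:
  assumes "0 < \<delta>"
  shows "\<forall>\<^sub>F k in sequentially. (\<Sum>i\<le>k div 2. b i) \<le> \<delta> * b k"
proof -
  obtain q where q: "\<rho> < q" "q < 1" using dense rho by blast
  have q0: "0 < q" using q rho by simp
  have "\<forall>\<^sub>F k in sequentially. b (k - 1) / b k < q"
    using order_tendstoD(2)[OF ratio] q by blast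
  then obtain i0 where i0: "\<And>k. k \<ge> i0 \<Longrightarrow> b (k - 1) / b k < q"
    unfolding eventually_sequentially by blast
  have step: "b k \<le> q * b (Suc k)" if "k \<ge> i0" for k
    using i0[of "Suc k"] that pos[of "Suc k"] by (simp add: field_simps)
  have geo: "b i \<le> q ^ j * b (i + j)" if "i \<ge> i0" for i j
  proof (induction j)
    case (Suc j)
    have "b i \<le> q ^ j * b (i + j)" by (rule Suc)
    also have "\<dots> \<le> q ^ j * (q * b (Suc (i + j)))"
      using step[of "i + j"] that q0 by (intro mult_left_mono) auto
    finally show ?case by (simp add: mult_ac)
  qed simp
  \<comment> \<open>The quotient handles the indices below \<open>i0\<close>, where no growth is
    known; the 1 handles the others.\<close>
  define B where "B = 1 + (\<Sum>i\<le>i0. b i) / (q ^ i0 * b i0)"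
  have B1: "B \<ge> 1"
    unfolding B_def using q0 nonneg by (auto intro!: divide_nonneg_nonneg sum_nonneg)
  have le: "b i \<le> B * q ^ (k - i) * b k" if "i \<le> k" "i0 \<le> k" for i k
  proof (cases "i0 \<le> i")
    case True
    have "b i \<le> 1 * (q ^ (k - i) * b k)" using geo[OF True, of "k - i"] that by simp
    also have "\<dots> \<le> B * (q ^ (k - i) * b k)"
      using B1 q0 nonneg by (intro mult_right_mono) auto
    finally show ?thesis by simp
  next
    case False
    have "b i \<le> (\<Sum>i\<le>i0. b i)"
      using False nonneg by (intro member_le_sum) auto
    also have "\<dots> \<le> B * (q ^ i0 * b i0)"
      using q0 pos[of i0] by (simp add: B_def field_simps)
    also have "\<dots> \<le> B * (q ^ i0 * (q ^ (k - i0) * b k))"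
      using geo[of i0 "k - i0"] that q0 B1 by (intro mult_left_mono) auto
    also have "\<dots> = B * (q ^ k * b k)"
      using that by (simp add: power_add[symmetric])
    also have "\<dots> \<le> B * (q ^ (k - i) * b k)"
      using q0 q B1 nonneg by (intro mult_left_mono mult_right_mono power_decreasing) auto
    finally show ?thesis by simp
  qed
  \<comment> \<open>For i \<le> k/2 the exponent k - i is at least k/2, so
    \<open>q ^ (k - i)\<close> is at most \<open>r ^ k\<close>.\<close>
  define r where "r = sqrt q"
  have r: "0 < r" "r < 1" "r ^ 2 = q" using q q0 by (auto simp: r_def)
  have "(\<lambda>k. B * (real k * r ^ k + r ^ k)) \<longlonglongrightarrow> B * (0 + 0)"
    using r by (intro tendsto_intros powser_times_n_limit_0 LIMSEQ_power_zero) auto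
  then have "\<forall>\<^sub>F k in sequentially. B * (real k * r ^ k + r ^ k) < \<delta>"
    using assms by (intro order_tendstoD) auto
  then show ?thesis using eventually_ge_at_top[of i0]
  proof eventually_elim
    case (elim k)
    have "b i \<le> B * r ^ k * b k" if "i \<le> k div 2" for i
    proof -
      have "b i \<le> B * q ^ (k - i) * b k" using elim that by (intro le) auto
      also have "q ^ (k - i) = r ^ (2 * (k - i))" using r by (simp add: power_mult)
      also have "B * r ^ (2 * (k - i)) * b k \<le> B * r ^ k * b k"
        using r B1 nonneg that by (intro mult_left_mono mult_right_mono power_decreasing) auto
      finally show ?thesis .
    qed
    then have "(\<Sum>i\<le>k div 2. b i) \<le> (\<Sum>i\<le>k div 2. B * r ^ k * b k)"
      by (intro sum_mono) auto
    also have "\<dots> = real (Suc (k div 2)) * (B * r ^ k * b k)" by simp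
    also have "\<dots> \<le> real (Suc k) * (B * r ^ k * b k)"
      using r B1 nonneg by (intro mult_right_mono) auto
    also have "\<dots> = B * (real k * r ^ k + r ^ k) * b k" by (simp add: algebra_simps)
    also have "\<dots> \<le> \<delta> * b k" using elim nonneg by (intro mult_right_mono) auto
    finally show ?case .
  qed
qed

lemma half_moment_small:
  assumes "0 < \<delta>"
  shows "\<forall>\<^sub>F k in sequentially. (\<Sum>i\<le>k div 2. real i * b i) \<le> \<delta> * real k * b k"
  using half_sum_small[OF assms]
proof eventually_elim
  case (elim k)
  have "(\<Sum>i\<le>k div 2. real i * b i) \<le> (\<Sum>i\<le>k div 2. real k * b i)"
    using nonneg by (intro sum_mono mult_right_mono) auto
  also have "\<dots> = real k * (\<Sum>i\<le>k div 2. b i)" by (simp add: sum_distrib_left)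
  also have "\<dots> \<le> real k * (\<delta> * b k)" using elim by (intro mult_left_mono) auto
  finally show ?case by (simp add: mult_ac)
qed

lemma half_moment_bounded:
  obtains A where "0 < A"
    "\<And>k. real k * b k + (\<Sum>i\<le>k div 2. real i * b i) \<le> A * real k * b k"
proof -
  let ?\<tau> = "\<lambda>k. \<Sum>i\<le>k div 2. real i * b i"
  obtain k0 where k0: "\<And>k. k \<ge> k0 \<Longrightarrow> ?\<tau> k \<le> 1 * real k * b k"
    using half_moment_small[of 1] unfolding eventually_sequentially by auto
  \<comment> \<open>The 2 covers all large k and the sum the finitely many others; at k = 0 both
    sides of the claim vanish.\<close>
  define A where "A = 2 + (\<Sum>k\<le>k0. ?\<tau> k / (real k * b k))"
  have nn: "0 \<le> ?\<tau> k / (real k * b k)" for k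
    using nonneg by (intro divide_nonneg_nonneg sum_nonneg mult_nonneg_nonneg) auto
  have "real k * b k + ?\<tau> k \<le> A * real k * b k" for k
  proof (cases "k = 0 \<or> k \<ge> k0")
    case True
    have "2 * (real k * b k) \<le> A * (real k * b k)"
      using nn nonneg by (intro mult_right_mono) (auto simp: A_def intro!: sum_nonneg)
    then show ?thesis using True k0[of k] by auto
  next
    case False
    have kb: "0 < real k * b k" using False pos by simp
    have "?\<tau> k / (real k * b k) \<le> (\<Sum>k\<le>k0. ?\<tau> k / (real k * b k))"
      using False nn by (intro member_le_sum) auto
    then have "?\<tau> k / (real k * b k) \<le> A - 1" by (simp add: A_def)
    then have "?\<tau> k \<le> (A - 1) * (real k * b k)"
      using kb by (simp add: pos_divide_le_eq)
    then show ?thesis by (simp add: algebra_simps)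
  qed
  moreover have "A > 0" using nn by (auto simp: A_def intro!: add_pos_nonneg sum_nonneg)
  ultimately show thesis using that by blast
qed

lemma split_sum:
  fixes t :: "nat \<Rightarrow> real"
  assumes "2 * K < s"
  shows "sum t {1..s} = sum t {1..K} + sum t {K<..<s-K} + (\<Sum>r\<le>K. t (s - r))"
proof -
  have "{1..s} = ({1..K} \<union> {K<..<s-K}) \<union> {s - K..s}" using assms by auto
  then have "sum t {1..s} = sum t {1..K} + sum t {K<..<s-K} + sum t {s - K..s}"
    using assms by (simp only:) (subst sum.union_disjoint; (subst sum.union_disjoint)?; auto)
  moreover have "sum t {s - K..s} = (\<Sum>r\<le>K. t (s - r))"
    using assms by (intro sum.reindex_bij_witness[of _ "\<lambda>k. s - k" "\<lambda>k. s - k"]) auto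
  ultimately show ?thesis by simp
qed

text \<open>
  In the recursion, indices \<open>k\<close> near \<open>0\<close> carry the small factor \<open>k / s\<close>, middle indices are
  controlled by subexponentiality, and indices near \<open>s\<close> only involve the first few values of \<open>h\<close>;
  so the induction constant is reproduced with a factor below one.
\<close>

lemma recursive_bound:
  fixes h :: "nat \<Rightarrow> real"
  assumes h: "\<And>s. 0 \<le> h s" and A: "0 < A"
    and rec: "\<And>s. real s * h s \<le> (\<Sum>k=1..s. A * real k * b k * h (s - k))"
  obtains C where "0 < C" "\<And>s. h s \<le> C * b s"
proof -
  \<comment> \<open>The target \<open>real s * C * b s\<close> is shared out: a quarter to the
    indices up to K, a quarter to the middle, a half to the indices near s. The factor 1 / (4 * A)
    secures the quarter of the middle, and s \<ge> 4 * A * K * E that of the small indices.\<close>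
  obtain K where K: "\<forall>\<^sub>F s in sequentially. (\<Sum>k\<in>{K<..<s-K}. b k * b (s - k)) \<le> 1 / (4 * A) * b s"
    using middle[of "1 / (4 * A)"] A by auto
  obtain E where E: "0 < E" "\<forall>\<^sub>F s in sequentially. (\<Sum>k\<le>K. b k * b (s - k)) \<le> E * b s"
    by (rule end_sum_bounded)
  have "\<forall>\<^sub>F s in sequentially. (\<Sum>k\<in>{K<..<s-K}. b k * b (s - k)) \<le> 1 / (4 * A) * b s \<and>
     (\<Sum>k\<le>K. b k * b (s - k)) \<le> E * b s \<and> real s \<ge> 4 * A * K * E \<and> 2 * K < s"
    using K E(2) eventually_ge_at_top[of "nat \<lceil>4 * A * K * E\<rceil>"] eventually_gt_at_top[of "2*K"]
    by eventually_elim linarith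
  then obtain s0 where s0: "\<And>s. s \<ge> s0 \<Longrightarrow>
     (\<Sum>k\<in>{K<..<s-K}. b k * b (s - k)) \<le> 1 / (4 * A) * b s \<and>
     (\<Sum>k\<le>K. b k * b (s - k)) \<le> E * b s \<and> real s \<ge> 4 * A * K * E \<and> 2 * K < s"
    unfolding eventually_sequentially by blast
  \<comment> \<open>\<open>Q\<close> bounds h / b on the first indices directly, not through the
    induction hypothesis. So \<open>C\<close> can be chosen large against it, and the range near s
    stays within its half.\<close>
  define Q where "Q = (\<Sum>r\<le>K. h r / b r)"
  define C where "C = 1 + 2 * A * Q * E + (\<Sum>s\<le>s0. h s / b s)"
  have hb: "0 \<le> h s / b s" for s using h nonneg by simp
  have Q0: "0 \<le> Q" unfolding Q_def by (intro sum_nonneg hb)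
  have sum0: "0 \<le> (\<Sum>s\<le>s0. h s / b s)" by (intro sum_nonneg hb)
  have C0: "0 < C" using Q0 sum0 A E by (auto simp: C_def intro!: add_pos_nonneg)
  have C1: "2 * A * Q * E \<le> C" using sum0 by (simp add: C_def)
  have hQ: "h r \<le> Q * b r" if "r \<le> K" for r
  proof -
    have "h r / b r \<le> Q" unfolding Q_def using that hb by (intro member_le_sum) auto
    then show ?thesis using pos[of r] by (simp add: pos_divide_le_eq)
  qed
  have "h s \<le> C * b s" for s
  proof (induction s rule: less_induct)
    case (less s)
    show ?case
    proof (cases "s < s0")
      case True
      have "h s / b s \<le> (\<Sum>s\<le>s0. h s / b s)" using True hb by (intro member_le_sum) auto
      also have "\<dots> \<le> C" using A Q0 E by (simp add: C_def)
      finally show ?thesis using pos[of s] by (simp add: pos_divide_le_eq)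
    next
      case False
      then have s: "(\<Sum>k\<in>{K<..<s-K}. b k * b (s - k)) \<le> 1 / (4 * A) * b s"
        "(\<Sum>k\<le>K. b k * b (s - k)) \<le> E * b s" "real s \<ge> 4 * A * K * E" "2 * K < s"
        using s0[of s] by auto
      let ?t = "\<lambda>k. A * real k * b k * h (s - k)"
      have "sum ?t {1..K} \<le> (\<Sum>k\<in>{1..K}. A * real K * C * (b k * b (s - k)))"
      proof (rule sum_mono)
        fix k assume k: "k \<in> {1..K}"
        then have "h (s - k) \<le> C * b (s - k)" using s by (intro less.IH) auto
        then have "A * real k * b k * h (s - k) \<le> A * real K * b k * (C * b (s - k))"
          using A k nonneg h C0 by (intro mult_mono mult_nonneg_nonneg) auto
        then show "?t k \<le> A * real K * C * (b k * b (s - k))" by (simp add: mult_ac)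
      qed
      also have "\<dots> = A * real K * C * (\<Sum>k\<in>{1..K}. b k * b (s - k))"
        by (simp add: sum_distrib_left)
      also have "\<dots> \<le> A * real K * C * (\<Sum>k\<le>K. b k * b (s - k))"
        using A C0 nonneg by (intro mult_left_mono sum_mono2) auto
      also have "\<dots> \<le> A * real K * C * (E * b s)"
        using A C0 s by (intro mult_left_mono) auto
      also have "\<dots> = (A * real K * E) * (C * b s)" by simp
      also have "\<dots> \<le> (real s / 4) * (C * b s)"
        using s C0 nonneg by (intro mult_right_mono) auto
      finally have 1: "sum ?t {1..K} \<le> real s * C * b s / 4" by (simp add: mult_ac)
      have "sum ?t {K<..<s-K} \<le> (\<Sum>k\<in>{K<..<s-K}. A * real s * C * (b k * b (s - k)))"
      proof (rule sum_mono)
        fix k assume k: "k \<in> {K<..<s-K}"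
        then have "h (s - k) \<le> C * b (s - k)" using s by (intro less.IH) auto
        then have "A * real k * b k * h (s - k) \<le> A * real s * b k * (C * b (s - k))"
          using A k nonneg h C0 by (intro mult_mono mult_nonneg_nonneg) auto
        then show "?t k \<le> A * real s * C * (b k * b (s - k))" by (simp add: mult_ac)
      qed
      also have "\<dots> = A * real s * C * (\<Sum>k\<in>{K<..<s-K}. b k * b (s - k))"
        by (simp add: sum_distrib_left)
      also have "\<dots> \<le> A * real s * C * (1 / (4 * A) * b s)"
        using A C0 s by (intro mult_left_mono) auto
      also have "\<dots> = real s * C * b s / 4" using A by simp
      finally have 2: "sum ?t {K<..<s-K} \<le> real s * C * b s / 4" .
      have "(\<Sum>r\<le>K. ?t (s - r)) \<le> (\<Sum>r\<le>K. A * real s * Q * (b r * b (s - r)))"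
      proof (rule sum_mono)
        fix r assume r: "r \<in> {..K}"
        then have "A * real (s - r) * b (s - r) * h r \<le> A * real s * b (s - r) * (Q * b r)"
          using A nonneg h hQ[of r] by (intro mult_mono mult_nonneg_nonneg) auto
        then show "?t (s - r) \<le> A * real s * Q * (b r * b (s - r))"
          using s r by (simp add: mult_ac)
      qed
      also have "\<dots> = A * real s * Q * (\<Sum>r\<le>K. b r * b (s - r))"
        by (simp add: sum_distrib_left)
      also have "\<dots> \<le> A * real s * Q * (E * b s)"
        using A Q0 s by (intro mult_left_mono) auto
      also have "\<dots> = (2 * A * Q * E) * (real s * b s / 2)" by simp
      also have "\<dots> \<le> C * (real s * b s / 2)"
        using C1 nonneg by (intro mult_right_mono) auto
      finally have 3: "(\<Sum>r\<le>K. ?t (s - r)) \<le> real s * C * b s / 2" by (simp add: mult_ac)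
      have "real s * h s \<le> real s * C * b s"
        using rec[of s] split_sum[OF s(4), of ?t] 1 2 3 by argo
      then show ?thesis using s(4) by (simp add: mult.assoc)
    qed
  qed
  then show thesis using that C0 by blast
qed

text \<open>The three ranges are those of the recursion, but near s the leading term is cut off and
  only the half sum survives, which is small relative to \<open>real k * b k\<close> for large k. So
  every range can be held to a third of \<open>\<epsilon> * real s * b s\<close>.\<close>

lemma tail_sum_small:
  fixes h :: "nat \<Rightarrow> real"
  assumes h: "\<And>s. 0 \<le> h s" "\<And>s. h s \<le> C * b s" and C: "0 < C" and "0 < \<epsilon>"
  obtains K where "\<forall>\<^sub>F s in sequentially.
      (\<Sum>k=1..s. ((if k < s - K then real k * b k else 0) +
         (\<Sum>i\<le>k div 2. real i * b i)) * h (s - k)) \<le> \<epsilon> * real s * b s"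
proof -
  let ?\<tau> = "\<lambda>k. \<Sum>i\<le>k div 2. real i * b i"
  obtain A where A: "0 < A" "\<And>k. real k * b k + ?\<tau> k \<le> A * real k * b k"
    using half_moment_bounded by blast
  obtain K where K: "\<forall>\<^sub>F s in sequentially.
      (\<Sum>k\<in>{K<..<s-K}. b k * b (s - k)) \<le> \<epsilon> / (3 * A * C) * b s"
    using middle[of "\<epsilon> / (3 * A * C)"] A C \<open>0 < \<epsilon>\<close> by auto
  obtain E where E: "0 < E" "\<forall>\<^sub>F s in sequentially. (\<Sum>k\<le>K. b k * b (s - k)) \<le> E * b s"
    by (rule end_sum_bounded)
  \<comment> \<open>\<delta> comes after \<open>K\<close>, since \<open>E\<close> depends on K.
    Taking s beyond \<open>k0 + K\<close> then puts every index s - r with r \<le> K where the half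
    sum is small.\<close>
  define \<delta> where "\<delta> = \<epsilon> / (3 * C * E)"
  have \<delta>: "0 < \<delta>" using C E \<open>0 < \<epsilon>\<close> by (simp add: \<delta>_def)
  obtain k0 where k0: "\<And>k. k \<ge> k0 \<Longrightarrow> ?\<tau> k \<le> \<delta> * real k * b k"
    using half_moment_small[OF \<delta>] unfolding eventually_sequentially by auto
  have \<tau>0: "0 \<le> ?\<tau> k" for k using nonneg by (intro sum_nonneg mult_nonneg_nonneg) auto
  have "\<forall>\<^sub>F s in sequentially.
      (\<Sum>k=1..s. ((if k < s - K then real k * b k else 0) + ?\<tau> k) * h (s - k)) \<le> \<epsilon> * real s * b s"
    using K E(2) eventually_ge_at_top[of "nat \<lceil>3 * A * K * C * E / \<epsilon>\<rceil>"]
      eventually_gt_at_top[of "2*K"] eventually_ge_at_top[of "k0 + K"]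
  proof eventually_elim
    case (elim s)
    let ?t = "\<lambda>k. ((if k < s - K then real k * b k else 0) + ?\<tau> k) * h (s - k)"
    have t: "?t k \<le> A * real k' * C * (b k * b (s - k))" if "k \<le> k'" for k k'
    proof -
      have "(if k < s - K then real k * b k else 0) + ?\<tau> k \<le> real k * b k + ?\<tau> k"
        using nonneg by auto
      also have "\<dots> \<le> A * real k * b k" by (rule A)
      also have "\<dots> \<le> A * real k' * b k"
        using A that nonneg by (intro mult_right_mono mult_left_mono) auto
      finally have "?t k \<le> A * real k' * b k * (C * b (s - k))"
        using A h nonneg by (intro mult_mono mult_nonneg_nonneg) auto
      then show ?thesis by (simp add: mult_ac)
    qed
    have "sum ?t {1..K} \<le> (\<Sum>k\<in>{1..K}. A * real K * C * (b k * b (s - k)))"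
      by (intro sum_mono t) auto
    also have "\<dots> = A * real K * C * (\<Sum>k\<in>{1..K}. b k * b (s - k))"
      by (simp add: sum_distrib_left)
    also have "\<dots> \<le> A * real K * C * (\<Sum>k\<le>K. b k * b (s - k))"
      using A C nonneg by (intro mult_left_mono sum_mono2) auto
    also have "\<dots> \<le> A * real K * C * (E * b s)"
      using A C elim by (intro mult_left_mono) auto
    also have "\<dots> = (A * real K * C * E) * b s" by simp
    also have "\<dots> \<le> (\<epsilon> * real s / 3) * b s"
    proof (rule mult_right_mono[OF _ nonneg])
      have "3 * A * K * C * E / \<epsilon> \<le> real s" using elim by linarith
      then show "A * real K * C * E \<le> \<epsilon> * real s / 3"
        using \<open>0 < \<epsilon>\<close> by (simp add: field_simps)
    qed
    finally have 1: "sum ?t {1..K} \<le> \<epsilon> * real s * b s / 3" by simp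
    have "sum ?t {K<..<s-K} \<le> (\<Sum>k\<in>{K<..<s-K}. A * real s * C * (b k * b (s - k)))"
      by (intro sum_mono t) auto
    also have "\<dots> = A * real s * C * (\<Sum>k\<in>{K<..<s-K}. b k * b (s - k))"
      by (simp add: sum_distrib_left)
    also have "\<dots> \<le> A * real s * C * (\<epsilon> / (3 * A * C) * b s)"
      using A C elim by (intro mult_left_mono) auto
    also have "\<dots> = \<epsilon> * real s * b s / 3" using A C by simp
    finally have 2: "sum ?t {K<..<s-K} \<le> \<epsilon> * real s * b s / 3" .
    have "(\<Sum>r\<le>K. ?t (s - r)) \<le> (\<Sum>r\<le>K. \<delta> * real s * C * (b r * b (s - r)))"
    proof (rule sum_mono)
      fix r assume r: "r \<in> {..K}"
      have "?\<tau> (s - r) \<le> \<delta> * real (s - r) * b (s - r)" using elim r by (intro k0) auto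
      also have "\<dots> \<le> \<delta> * real s * b (s - r)"
        using \<delta> nonneg by (intro mult_right_mono mult_left_mono) auto
      finally have "?\<tau> (s - r) * h r \<le> \<delta> * real s * b (s - r) * (C * b r)"
        using \<delta> h nonneg by (intro mult_mono mult_nonneg_nonneg) auto
      then show "?t (s - r) \<le> \<delta> * real s * C * (b r * b (s - r))"
        using elim r by (simp add: mult_ac)
    qed
    also have "\<dots> = \<delta> * real s * C * (\<Sum>r\<le>K. b r * b (s - r))"
      by (simp add: sum_distrib_left)
    also have "\<dots> \<le> \<delta> * real s * C * (E * b s)"
      using \<delta> C elim by (intro mult_left_mono) auto
    also have "\<dots> = \<epsilon> * real s * b s / 3" using C E by (simp add: \<delta>_def)
    finally have 3: "(\<Sum>r\<le>K. ?t (s - r)) \<le> \<epsilon> * real s * b s / 3" .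
    show ?case
      using split_sum[OF elim(4), of ?t] 1 2 3 by argo
  qed
  then show thesis using that by blast
qed

end

text \<open>Positive integer coefficients are at least 1, so the maximum with 1 alters only finitely
  many values. The same integrality yields \<rho> < 1, because \<open>c k * \<rho> ^ k\<close> tends
  to 0 while \<open>c k\<close> is eventually at least 1.\<close>

lemma subexponential_weights_shift:
  fixes c :: "nat \<Rightarrow> nat"
  assumes sub: "subexponential (\<lambda>k. real (c k)) \<rho>"
  shows "subexponential_weights (\<lambda>k. max 1 (real (c (k + m)))) \<rho>"
proof -
  note S = sub[unfolded subexponential_def]
  let ?b = "\<lambda>k. max 1 (real (c (k + m)))"
  have pos: "\<forall>\<^sub>F n in sequentially. real (c n) > 0" using S by auto
  then obtain k0 where k0: "\<And>k. k \<ge> k0 \<Longrightarrow> c k > 0"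
    unfolding eventually_sequentially by auto
  have bc: "?b k = real (c (k + m))" if "k \<ge> k0" for k
    using k0[of "k + m"] that by auto
  show ?thesis
  proof
    show "0 < ?b k" for k by simp
    show "0 < \<rho>" using S by simp
    have "(\<lambda>k. real (c k) * \<rho> ^ k) \<longlonglongrightarrow> 0" using S summable_LIMSEQ_zero by blast
    then have "\<forall>\<^sub>F k in sequentially. real (c k) * \<rho> ^ k < 1" by (rule order_tendstoD) simp
    then have "\<forall>\<^sub>F k in sequentially. real (c k) * \<rho> ^ k < 1 \<and> real (c k) > 0"
      using pos by eventually_elim auto
    then obtain k where k: "real (c k) * \<rho> ^ k < 1" "real (c k) > 0"
      unfolding eventually_sequentially by auto
    have "\<rho> ^ k \<le> real (c k) * \<rho> ^ k"
      using k \<open>0 < \<rho>\<close> by (intro mult_le_cancel_right1[THEN iffD2]) auto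
    then have "\<rho> ^ k < 1" using k by simp
    then show "\<rho> < 1" by (metis linorder_not_le one_le_power)
    have "(\<lambda>k. real (c (k + m - 1)) / real (c (k + m))) \<longlonglongrightarrow> \<rho>"
      using LIMSEQ_ignore_initial_segment[of "\<lambda>n. real (c (n - 1)) / real (c n)" \<rho> m] S by simp
    moreover have "\<forall>\<^sub>F k in sequentially.
        real (c (k + m - 1)) / real (c (k + m)) = ?b (k - 1) / ?b k"
      using eventually_ge_at_top[of "Suc k0"]
    proof eventually_elim
      case (elim k)
      then have "k - 1 + m = k + m - 1" by simp
      then show ?case using elim bc[of k] bc[of "k - 1"] by simp
    qed
    ultimately show "(\<lambda>k. ?b (k - 1) / ?b k) \<longlonglongrightarrow> \<rho>"
      by (rule Lim_transform_eventually)
    fix \<epsilon> :: real assume "0 < \<epsilon>"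
    \<comment> \<open>Shifting both factors by m turns the convolution at s into one at s + 2m, and
      \<open>c (s + 2 * m)\<close> is eventually at most \<open>2 / \<rho> ^ m\<close> times
      \<open>c (s + m)\<close>; \<eta> pays for this factor.\<close>
    define \<eta> where "\<eta> = \<epsilon> * \<rho> ^ m / 2"
    have \<eta>: "\<eta> > 0" using \<open>0 < \<epsilon>\<close> \<open>0 < \<rho>\<close> by (simp add: \<eta>_def)
    obtain K0 where K0: "\<And>K. K0 \<le> K \<Longrightarrow> \<forall>\<^sub>F n in sequentially.
         (\<Sum>k\<in>{K<..<n-K}. real (c k) * real (c (n - k))) \<le> \<eta> * real (c n)"
      by (rule subexponential_middle_sum[OF sub _ \<eta>]) auto
    \<comment> \<open>With K \<ge> k0 the maximum with 1 is inactive at both k and s - k throughout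
      the middle range.\<close>
    define K where "K = max K0 k0"
    have 1: "\<forall>\<^sub>F s in sequentially.
        (\<Sum>k\<in>{K<..<s+2*m-K}. real (c k) * real (c (s+2*m - k))) \<le> \<eta> * real (c (s+2*m))"
      using eventually_sequentially_seg[THEN iffD2, OF K0, of K "2 * m"] by (simp add: K_def)
    have "(\<lambda>s. real (c (s - m)) / real (c s)) \<longlonglongrightarrow> \<rho> ^ m"
      using S by (intro shift_ratio_tendsto) (auto elim: eventually_mono)
    then have "\<forall>\<^sub>F s in sequentially. real (c (s - m)) / real (c s) > \<rho> ^ m / 2"
      using \<open>0 < \<rho>\<close> by (intro order_tendstoD) auto
    then have 2: "\<forall>\<^sub>F s in sequentially.
         real (c (s + 2 * m - m)) / real (c (s + 2 * m)) > \<rho> ^ m / 2"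
      using eventually_sequentially_seg[THEN iffD2, of _ "2 * m"] by blast
    have "\<forall>\<^sub>F s in sequentially. (\<Sum>k\<in>{K<..<s-K}. ?b k * ?b (s - k)) \<le> \<epsilon> * ?b s"
      using 1 2 eventually_ge_at_top[of k0]
    proof eventually_elim
      case (elim s)
      have "(\<Sum>k\<in>{K<..<s-K}. ?b k * ?b (s - k))
          = (\<Sum>k\<in>{K<..<s-K}. real (c (k + m)) * real (c (s + 2 * m - (k + m))))"
      proof (rule sum.cong[OF refl])
        fix k assume k: "k \<in> {K<..<s-K}"
        then have "?b k = real (c (k + m))" "?b (s - k) = real (c (s - k + m))"
          using bc[of k] bc[of "s - k"] by (auto simp: K_def)
        moreover have "s - k + m = s + 2 * m - (k + m)" using k by auto
        ultimately show "?b k * ?b (s - k) = real (c (k + m)) * real (c (s + 2 * m - (k + m)))"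
          by simp
      qed
      also have "\<dots> = (\<Sum>k\<in>(\<lambda>k. k + m) ` {K<..<s-K}. real (c k) * real (c (s + 2 * m - k)))"
        by (subst sum.reindex) auto
      also have "\<dots> \<le> (\<Sum>k\<in>{K<..<s+2*m-K}. real (c k) * real (c (s+2*m - k)))"
        by (intro sum_mono2) auto
      also have "\<dots> \<le> \<eta> * real (c (s + 2 * m))" by (rule elim)
      also have "\<dots> \<le> \<epsilon> * real (c (s + m))"
      proof -
        have "0 < c (s + 2 * m)" using elim by (intro k0) auto
        then have "\<rho> ^ m / 2 * real (c (s + 2 * m)) \<le> real (c (s + m))"
          using elim(2) by (simp add: pos_less_divide_eq add.commute)
        then have "\<epsilon> * (\<rho> ^ m / 2 * real (c (s + 2 * m))) \<le> \<epsilon> * real (c (s + m))"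
          using \<open>0 < \<epsilon>\<close> by (intro mult_left_mono) auto
        then show ?thesis by (simp add: \<eta>_def)
      qed
      also have "\<dots> \<le> \<epsilon> * ?b s" using \<open>0 < \<epsilon>\<close> by (intro mult_left_mono) auto
      finally show ?case .
    qed
    then show "\<exists>K. \<forall>\<^sub>F s in sequentially.
        (\<Sum>k\<in>{K<..<s-K}. ?b k * ?b (s - k)) \<le> \<epsilon> * ?b s" by blast
  qed
qed

section \<open>Counting multisets by weight\<close>

lemma sum_mset_eq_sum_count:
  fixes f :: "'a \<Rightarrow> 'b :: comm_semiring_1"
  assumes "finite A" "set_mset M \<subseteq> A"
  shows "(\<Sum>x\<in>#M. f x) = (\<Sum>x\<in>A. of_nat (count M x) * f x)"
  using assms(2)
proof (induction M)
  case (add y M)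
  have "(\<Sum>x\<in>A. of_nat (count (add_mset y M) x) * f x)
      = (\<Sum>x\<in>A. of_nat (count M x) * f x + (if x = y then f x else 0))"
    by (intro sum.cong) (auto simp: algebra_simps)
  also have "\<dots> = (\<Sum>x\<in>A. of_nat (count M x) * f x) + f y"
    using add.prems assms(1) by (simp add: sum.distrib)
  finally show ?case using add by (simp add: add_ac)
qed simp

text \<open>Every multiset of size j + 1 arises by adding one element to one of size j. The factor
  is crude but independent of j, and it is the price of one additional minimal component.\<close>

lemma card_multisets_of_size_Suc_le:
  assumes "finite A"
  shows "card (multisets_of_size A (Suc j)) \<le> card A * card (multisets_of_size A j)"
proof -
  have "multisets_of_size A (Suc j) \<subseteq> (\<lambda>(x, M). add_mset x M) ` (A \<times> multisets_of_size A j)"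
  proof
    fix M assume M: "M \<in> multisets_of_size A (Suc j)"
    then obtain x M' where "M = add_mset x M'"
      by (auto simp: multisets_of_size_def dest: size_eq_Suc_imp_eq_union)
    then show "M \<in> (\<lambda>(x, M). add_mset x M) ` (A \<times> multisets_of_size A j)"
      using M by (force simp: multisets_of_size_def)
  qed
  then have "card (multisets_of_size A (Suc j)) \<le> card (A \<times> multisets_of_size A j)"
    using assms by (meson finite_SigmaI finite_multisets_of_size surj_card_le)
  then show ?thesis by (simp add: card_cartesian_product)
qed

text \<open>Padding with copies of one fixed element is injective. Thus a core with more members has
  at most as many completions as one with fewer.\<close>

lemma card_multisets_of_size_mono:
  assumes "finite A" "A \<noteq> {}" "i \<le> j"
  shows "card (multisets_of_size A i) \<le> card (multisets_of_size A j)"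
proof -
  obtain x where x: "x \<in> A" using assms by blast
  show ?thesis
  proof (rule card_inj_on_le)
    show "inj_on (\<lambda>M. M + replicate_mset (j - i) x) (multisets_of_size A i)"
      by (auto simp: inj_on_def)
    show "(\<lambda>M. M + replicate_mset (j - i) x) ` multisets_of_size A i \<subseteq> multisets_of_size A j"
      using x assms by (auto simp: multisets_of_size_def split: if_splits)
    show "finite (multisets_of_size A j)" using assms by blast
  qed
qed

text \<open>By symmetry, every element of \<open>A\<close> has the same mean multiplicity.\<close>

lemma sum_multisets_of_size:
  fixes f :: "'a \<Rightarrow> real"
  assumes A: "finite A"
  shows "card A * (\<Sum>M\<in>multisets_of_size A j. \<Sum>x\<in>#M. f x)
       = j * card (multisets_of_size A j) * (\<Sum>x\<in>A. f x)"
proof -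
  let ?W = "multisets_of_size A j"
  define c where "c x = (\<Sum>M\<in>?W. real (count M x))" for x
  have c_eq: "c x = c y" if "x \<in> A" "y \<in> A" for x y
  proof -
    \<comment> \<open>Exchanging x and y inside every multiset is an involution of \<open>?W\<close>
      that carries the multiplicity of x to that of y.\<close>
    let ?\<pi> = "image_mset (Transposition.transpose x y)"
    show ?thesis unfolding c_def
    proof (rule sum.reindex_bij_witness[of _ ?\<pi> ?\<pi>])
    fix M assume M: "M \<in> ?W"
    show "?\<pi> (?\<pi> M) = M" "?\<pi> (?\<pi> M) = M" by (simp_all add: multiset.map_comp comp_def)
    show "?\<pi> M \<in> ?W" "?\<pi> M \<in> ?W"
      using M that by (auto simp: multisets_of_size_def Transposition.transpose_def)
    have "Transposition.transpose x y -` {y} \<inter> set_mset M = (if x \<in># M then {x} else {})"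
      by (auto simp: Transposition.transpose_def split: if_splits)
    then have "count (?\<pi> M) y = count M x"
      by (cases "x \<in># M") (simp_all add: count_image_mset count_eq_zero_iff)
    then show "real (count (?\<pi> M) y) = real (count M x)" by simp
    qed
  qed
  have cnt: "(\<Sum>M\<in>?W. \<Sum>x\<in>#M. g x) = (\<Sum>x\<in>A. c x * g x)" for g :: "'a \<Rightarrow> real"
  proof -
    have "(\<Sum>M\<in>?W. \<Sum>x\<in>#M. g x) = (\<Sum>M\<in>?W. \<Sum>x\<in>A. real (count M x) * g x)"
      using A by (intro sum.cong sum_mset_eq_sum_count) (auto simp: multisets_of_size_def)
    also have "\<dots> = (\<Sum>x\<in>A. c x * g x)"
      unfolding c_def sum_distrib_right by (rule sum.swap)
    finally show ?thesis .
  qed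
  have "(\<Sum>x\<in>A. c x) = (\<Sum>M\<in>?W. \<Sum>x\<in>#M. 1)" using cnt[of "\<lambda>_. 1"] by simp
  also have "\<dots> = (\<Sum>M\<in>?W. real j)"
    by (intro sum.cong) (auto simp: multisets_of_size_def)
  finally have tot: "(\<Sum>x\<in>A. c x) = real j * card ?W" by simp
  have mean: "card A * c x = real j * card ?W" if "x \<in> A" for x
  proof -
    have "(\<Sum>y\<in>A. c y) = (\<Sum>y\<in>A. c x)" by (intro sum.cong refl c_eq that)
    then show ?thesis using tot by simp
  qed
  show ?thesis
    unfolding cnt sum_distrib_left
  proof (intro sum.cong refl)
    fix x assume "x \<in> A"
    have "real (card A) * (c x * f x) = real j * real (card ?W) * f x"
      unfolding mean[OF \<open>x \<in> A\<close>, symmetric] by simp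
    then show "real (card A) * (c x * f x) = real (j * card ?W) * f x" by simp
  qed
qed

section \<open>A recursive inequality for multisets of given total weight\<close>

locale weighted_types =
  fixes D :: "'a set" and e :: "'a \<Rightarrow> nat"
  assumes weight_pos: "x \<in> D \<Longrightarrow> 0 < e x"
    and finite_level: "finite {x \<in> D. e x = k}"
begin

definition level :: "nat \<Rightarrow> 'a set" where
  "level k = {x \<in> D. e x = k}"

definition msets :: "nat \<Rightarrow> 'a multiset set" where
  "msets s = {M. set_mset M \<subseteq> D \<and> (\<Sum>x\<in>#M. e x) = s}"

lemma weight_le_sum: "x \<in># M \<Longrightarrow> e x \<le> (\<Sum>x\<in>#M. e x)"
  by (metis multi_member_split le_add1 sum_mset.insert image_mset_add_mset)

lemma size_le_sum: "set_mset M \<subseteq> D \<Longrightarrow> size M \<le> (\<Sum>x\<in>#M. e x)"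
proof (induction M)
  case (add x M)
  then show ?case using weight_pos[of x] by simp
qed simp

lemma finite_le: "finite {x \<in> D. e x \<le> s}"
proof -
  have "{x \<in> D. e x \<le> s} = (\<Union>k\<le>s. {x \<in> D. e x = k})" by auto
  then show ?thesis using finite_level by simp
qed

text \<open>Positive integer weights bound the number of members by s, and the members come from the
  finitely many elements of weight at most s.\<close>

lemma finite_msets: "finite (msets s)"
proof (rule finite_subset)
  show "msets s \<subseteq> (\<Union>j\<le>s. multisets_of_size {x \<in> D. e x \<le> s} j)"
    using size_le_sum weight_le_sum by (fastforce simp: msets_def multisets_of_size_def)
qed (use finite_le in auto)

text \<open>
  Counts triples of a multiset \<open>M\<close>, a member \<open>x\<close> and a number \<open>j\<close> of copies of \<open>x\<close> to be removed
  from \<open>M\<close>, each weighted by \<open>e x\<close>.  The first summand collects \<open>j = 1\<close>, the second one \<open>j \<ge> 2\<close>.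
\<close>

lemma weight_times_card_le:
  assumes P: "P \<subseteq> msets s" and L: "\<And>M x. M \<in> P \<Longrightarrow> x \<in># M \<Longrightarrow> e x < L"
  shows "s * card P \<le> (\<Sum>k=1..s. ((if k < L then k * card (level k) else 0) +
           (\<Sum>i\<le>k div 2. i * card (level i))) * card (msets (s - k)))"
proof -
  let ?D = "{x \<in> D. e x \<le> s}"
  have finP: "finite P" using P finite_msets finite_subset by blast
  \<comment> \<open>For a single copy the cutoff L is kept. For j \<ge> 2 it is dropped, since there
    the weight is at most half of what is removed.\<close>
  let ?ok = "\<lambda>x j. j = (1::nat) \<longrightarrow> e x < L"
  have M: "set_mset M \<subseteq> ?D" "(\<Sum>x\<in>#M. e x) = s" "size M \<le> s" if "M \<in> P" for M
    using that P size_le_sum[of M] weight_le_sum[of _ M] by (auto simp: msets_def)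
  have "s * card P = (\<Sum>M\<in>P. \<Sum>x\<in>#M. e x)" using M by simp
  also have "\<dots> = (\<Sum>M\<in>P. \<Sum>x\<in>?D. count M x * e x)"
    proof (rule sum.cong[OF refl])
    fix M assume "M \<in> P"
    then show "(\<Sum>x\<in>#M. e x) = (\<Sum>x\<in>?D. count M x * e x)"
      using sum_mset_eq_sum_count[OF finite_le M(1), of M e] by simp
  qed
  also have "\<dots> = (\<Sum>M\<in>P. \<Sum>x\<in>?D. \<Sum>j=1..s. if j \<le> count M x then e x else 0)"
  proof (intro sum.cong refl)
    fix M x assume "M \<in> P"
    then have "count M x \<le> s" using order_trans[OF count_le_size M(3)] by blast
    then have "{1..s} \<inter> {j. j \<le> count M x} = {1..count M x}" by auto
    then show "count M x * e x = (\<Sum>j=1..s. if j \<le> count M x then e x else 0)"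
      by (simp add: sum.If_cases)
  qed
  also have "\<dots> = (\<Sum>x\<in>?D. \<Sum>j=1..s. \<Sum>M\<in>P. if j \<le> count M x then e x else 0)"
    by (rule trans[OF sum.swap sum.cong[OF refl sum.swap]])
  also have "\<dots> = (\<Sum>x\<in>?D. \<Sum>j=1..s. e x * card {M \<in> P. j \<le> count M x})"
  proof (intro sum.cong refl)
    fix x j
    have "(\<Sum>M\<in>P. if j \<le> count M x then e x else 0) = (\<Sum>M\<in>{M \<in> P. j \<le> count M x}. e x)"
      using finP by (rule sum.inter_filter[symmetric])
    then show "(\<Sum>M\<in>P. if j \<le> count M x then e x else 0) = e x * card {M \<in> P. j \<le> count M x}"
      by simp
  qed
  also have "\<dots> \<le> (\<Sum>x\<in>?D. \<Sum>j=1..s. \<Sum>k=1..s.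
       (if j * e x = k \<and> ?ok x j then e x else 0) * card (msets (s - k)))"
  proof (intro sum_mono)
    fix x j assume x: "x \<in> ?D" and j: "j \<in> {1..s}"
    let ?Q = "{M \<in> P. j \<le> count M x}"
    show "e x * card ?Q \<le> (\<Sum>k=1..s. (if j * e x = k \<and> ?ok x j then e x else 0) * card (msets (s - k)))"
    proof (cases "?Q = {}")
      case True
      show ?thesis unfolding True by simp
    next
      case False
      then obtain M where "M \<in> P" "j \<le> count M x" by auto
      then have ok: "?ok x j" using L[of M x] j by (cases "x \<in># M") (auto simp: not_in_iff)
      have dec: "M - replicate_mset j x \<in> msets (s - j * e x)" "j * e x \<le> s"
        "M = (M - replicate_mset j x) + replicate_mset j x" if "M \<in> ?Q" for M
      proof -
        have "replicate_mset j x \<subseteq># M" using that by (simp add: count_le_replicate_mset_subset_eq)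
        then have M': "M = (M - replicate_mset j x) + replicate_mset j x" by simp
        then have "(\<Sum>x\<in>#M. e x) = (\<Sum>x\<in>#M - replicate_mset j x. e x) + j * e x"
          by (metis (no_types, lifting) image_mset_union sum_mset.union image_replicate_mset sum_mset_replicate_mset of_nat_id)
        then show "M - replicate_mset j x \<in> msets (s - j * e x)" "j * e x \<le> s"
            "M = (M - replicate_mset j x) + replicate_mset j x"
          using M[of M] that M' by (auto simp: msets_def dest: in_diffD)
      qed
      have "card ?Q \<le> card (msets (s - j * e x))"
      proof (rule card_inj_on_le)
        show "inj_on (\<lambda>M. M - replicate_mset j x) ?Q"
          using dec(3) by (metis (no_types, lifting) inj_onI)
        show "(\<lambda>M. M - replicate_mset j x) ` ?Q \<subseteq> msets (s - j * e x)" using dec(1) by blast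
      qed (rule finite_msets)
      then have "e x * card ?Q \<le>
          (\<Sum>k\<in>{j * e x}. (if j * e x = k \<and> ?ok x j then e x else 0) * card (msets (s - k)))"
        using ok by simp
      also have "\<dots> \<le> (\<Sum>k=1..s. (if j * e x = k \<and> ?ok x j then e x else 0) * card (msets (s - k)))"
        using dec(2) \<open>M \<in> P\<close> \<open>j \<le> count M x\<close> j x weight_pos[of x] by (intro sum_mono2) auto
      finally show ?thesis .
    qed
  qed
  also have "\<dots> = (\<Sum>k=1..s. \<Sum>x\<in>?D. \<Sum>j=1..s.
       (if j * e x = k \<and> ?ok x j then e x else 0) * card (msets (s - k)))"
    by (rule trans[OF sum.cong[OF refl sum.swap] sum.swap])
  also have "\<dots> = (\<Sum>k=1..s. (\<Sum>x\<in>?D. \<Sum>j=1..s.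
       (if j * e x = k \<and> ?ok x j then e x else 0)) * card (msets (s - k)))"
    by (simp add: sum_distrib_right)
  also have "\<dots> \<le> (\<Sum>k=1..s. ((if k < L then k * card (level k) else 0) +
           (\<Sum>i\<le>k div 2. i * card (level i))) * card (msets (s - k)))"
  proof (intro sum_mono mult_right_mono)
    fix k assume k: "k \<in> {1..s}"
    \<comment> \<open>Given x and k, at most one j satisfies \<open>j * e x = k\<close>: either j =
      1 and \<open>e x = k\<close>, or j \<ge> 2 and \<open>2 * e x \<le> k\<close>.\<close>
    have "(\<Sum>x\<in>?D. \<Sum>j=1..s. if j * e x = k \<and> ?ok x j then e x else 0)
        \<le> (\<Sum>x\<in>?D. (if e x = k \<and> k < L then e x else 0) + (if 2 * e x \<le> k then e x else 0))"
    proof (rule sum_mono)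
      fix x assume x: "x \<in> ?D"
      then have ex: "0 < e x" using weight_pos by auto
      show "(\<Sum>j=1..s. if j * e x = k \<and> ?ok x j then e x else 0)
          \<le> (if e x = k \<and> k < L then e x else 0) + (if 2 * e x \<le> k then e x else 0)"
      proof (cases "\<exists>j\<in>{1..s}. j * e x = k \<and> ?ok x j")
        case True
        then obtain j where j: "j \<in> {1..s}" "j * e x = k" "?ok x j" by blast
        have "(\<Sum>j'=1..s. if j' * e x = k \<and> ?ok x j' then e x else 0)
           = (\<Sum>j'=1..s. if j' = j then e x else 0)"
          using j ex by (intro sum.cong) auto
        also have "\<dots> = e x" using j by simp
        also have "\<dots> \<le> (if e x = k \<and> k < L then e x else 0) + (if 2 * e x \<le> k then e x else 0)"
        proof (cases "j = 1")
          case False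
          then have "2 * e x \<le> j * e x" using j by (intro mult_right_mono) auto
          then show ?thesis using j by simp
        qed (use j in auto)
        finally show ?thesis .
      next
        case False
        then have "(\<Sum>j=1..s. if j * e x = k \<and> ?ok x j then e x else 0) = 0"
          by (intro sum.neutral) auto
        then show ?thesis by simp
      qed
    qed
    also have "\<dots> = (\<Sum>x\<in>?D. if e x = k \<and> k < L then e x else 0) + (\<Sum>x\<in>?D. if 2 * e x \<le> k then e x else 0)"
      by (rule sum.distrib)
    also have "(\<Sum>x\<in>?D. if e x = k \<and> k < L then e x else 0) = (\<Sum>x\<in>level k. if k < L then k else 0)"
      using k finite_le by (intro sum.mono_neutral_cong_right) (auto simp: level_def)
    also have "\<dots> = (if k < L then k * card (level k) else 0)" by simp
    also have "(\<Sum>x\<in>?D. if 2 * e x \<le> k then e x else 0) = (\<Sum>x\<in>(\<Union>i\<le>k div 2. level i). e x)"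
      using k finite_le by (intro sum.mono_neutral_cong_right) (auto simp: level_def)
    also have "\<dots> = (\<Sum>i\<le>k div 2. \<Sum>x\<in>level i. e x)"
      using finite_level by (intro sum.UNION_disjoint) (auto simp: level_def)
    also have "\<dots> = (\<Sum>i\<le>k div 2. i * card (level i))"
      by (intro sum.cong) (auto simp: level_def)
    finally show "(\<Sum>x\<in>?D. \<Sum>j=1..s. if j * e x = k \<and> ?ok x j then e x else 0)
       \<le> (if k < L then k * card (level k) else 0) + (\<Sum>i\<le>k div 2. i * card (level i))" .
  qed simp
  finally show ?thesis .
qed

text \<open>The weighted counting inequality is used twice. With cutoff \<open>Suc s\<close>, which
  excludes nothing, it is the recursion that bounds \<open>?h\<close> by a multiple of
  \<open>b\<close>; with cutoff \<open>s - K\<close> and this bound it estimates the multisets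
  without a giant. The factor s then cancels.\<close>

lemma few_without_giant:
  assumes b: "subexponential_weights b \<rho>" and le: "\<And>k. real (card (level k)) \<le> b k" and "0 < \<epsilon>"
  obtains K where "\<forall>\<^sub>F s in sequentially.
      real (card {M \<in> msets s. \<forall>x\<in>#M. e x < s - K}) \<le> \<epsilon> * b s"
proof -
  interpret subexponential_weights b \<rho> by (rule b)
  let ?h = "\<lambda>s. real (card (msets s))"
  let ?\<tau> = "\<lambda>k. \<Sum>i\<le>k div 2. real i * b i"
  have real_bound: "real s * real (card P)
      \<le> (\<Sum>k=1..s. ((if k < L then real k * b k else 0) + ?\<tau> k) * ?h (s - k))"
    if "P \<subseteq> msets s" "\<And>M x. M \<in> P \<Longrightarrow> x \<in># M \<Longrightarrow> e x < L" for P s L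
  proof -
    have "real s * real (card P) = real (s * card P)" by simp
    also have "\<dots> \<le> real (\<Sum>k=1..s. ((if k < L then k * card (level k) else 0) +
           (\<Sum>i\<le>k div 2. i * card (level i))) * card (msets (s - k)))"
      using weight_times_card_le[OF that] by (rule of_nat_mono)
    also have "\<dots> = (\<Sum>k=1..s. ((if k < L then real k * real (card (level k)) else 0) +
           (\<Sum>i\<le>k div 2. real i * real (card (level i)))) * ?h (s - k))"
      by (simp only: of_nat_sum of_nat_mult of_nat_add if_distrib[of real] of_nat_0)
    also have "\<dots> \<le> (\<Sum>k=1..s. ((if k < L then real k * b k else 0) + ?\<tau> k) * ?h (s - k))"
    proof (intro sum_mono mult_right_mono add_mono)
      fix k show "(if k < L then real k * real (card (level k)) else 0) \<le> (if k < L then real k * b k else 0)"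
        using le[of k] by (simp add: mult_left_mono)
      fix i show "real i * real (card (level i)) \<le> real i * b i"
        using le[of i] by (simp add: mult_left_mono)
    qed simp
    finally show ?thesis .
  qed
  obtain A where A: "0 < A" "\<And>k. real k * b k + ?\<tau> k \<le> A * real k * b k"
    using half_moment_bounded by blast
  have "real s * ?h s \<le> (\<Sum>k=1..s. A * real k * b k * ?h (s - k))" for s
  proof -
    have "real s * ?h s \<le> (\<Sum>k=1..s. ((if k < Suc s then real k * b k else 0) + ?\<tau> k) * ?h (s - k))"
    proof (rule real_bound[OF order_refl])
      fix M x assume "M \<in> msets s" "x \<in># M"
      then show "e x < Suc s" using weight_le_sum[of x M] by (auto simp: msets_def)
    qed
    also have "\<dots> \<le> (\<Sum>k=1..s. A * real k * b k * ?h (s - k))"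
    proof (intro sum_mono mult_right_mono)
      fix k assume "k \<in> {1..s}"
      then show "(if k < Suc s then real k * b k else 0) + ?\<tau> k \<le> A * real k * b k"
        using A(2)[of k] by simp
    qed simp
    finally show ?thesis .
  qed
  then obtain C where C: "0 < C" "\<And>s. ?h s \<le> C * b s"
    using recursive_bound[of ?h A] A by auto
  obtain K where K: "\<forall>\<^sub>F s in sequentially.
      (\<Sum>k=1..s. ((if k < s - K then real k * b k else 0) + ?\<tau> k) * ?h (s - k)) \<le> \<epsilon> * real s * b s"
    using tail_sum_small[of ?h C \<epsilon>] C \<open>0 < \<epsilon>\<close> by auto
  have "\<forall>\<^sub>F s in sequentially. real (card {M \<in> msets s. \<forall>x\<in>#M. e x < s - K}) \<le> \<epsilon> * b s"
    using K eventually_gt_at_top[of 0]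
  proof eventually_elim
    case (elim s)
    have "real s * real (card {M \<in> msets s. \<forall>x\<in>#M. e x < s - K}) \<le> \<epsilon> * real s * b s"
      by (rule order_trans[OF real_bound elim(1)]) auto
    then have "real s * real (card {M \<in> msets s. \<forall>x\<in>#M. e x < s - K}) \<le> real s * (\<epsilon> * b s)"
      by (simp add: mult_ac)
    then show ?case using elim by simp
  qed
  then show thesis using that by blast
qed

end

section \<open>Random multisets with many components\<close>

lemma filter_mset_all: "(\<And>x. x \<in># M \<Longrightarrow> P x) \<Longrightarrow> filter_mset P M = M"
  by (induction M) auto

lemma filter_mset_none: "(\<And>x. x \<in># M \<Longrightarrow> \<not> P x) \<Longrightarrow> filter_mset P M = {#}"
  by (induction M) auto

section \<open>Decomposition of a configuration into its core and its minimal members\<close>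

locale component_class =
  fixes \<C> :: "'a set" and sz :: "'a \<Rightarrow> nat" and m :: nat
  assumes finite_sz: "finite {x \<in> \<C>. sz x = k}"
    and min_le: "x \<in> \<C> \<Longrightarrow> m \<le> sz x"
    and min_attained: "{x \<in> \<C>. sz x = m} \<noteq> {}"
    and min_pos: "0 < m"
begin

definition minimal :: "'a set" where
  "minimal = {x \<in> \<C>. sz x = m}"

definition larger :: "'a set" where
  "larger = {x \<in> \<C>. m < sz x}"

definition excess :: "'a \<Rightarrow> nat" where
  "excess x = sz x - m"

lemma excess_level: "{x \<in> larger. excess x = k} = (if k = 0 then {} else {x \<in> \<C>. sz x = k + m})"
  by (auto simp: larger_def excess_def)

sublocale weighted_types larger excess
proof
  show "0 < excess x" if "x \<in> larger" for x
    using that by (auto simp: larger_def excess_def)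
  show "finite {x \<in> larger. excess x = k}" for k
    using finite_sz by (simp add: excess_level)
qed

lemma level_eq: "0 < k \<Longrightarrow> level k = {x \<in> \<C>. sz x = k + m}"
  using excess_level[of k] by (simp add: level_def)

lemma finite_minimal: "finite minimal" and minimal_nonempty: "minimal \<noteq> {}"
  using finite_sz min_attained by (auto simp: minimal_def)

definition configs :: "nat \<Rightarrow> nat \<Rightarrow> 'a multiset set" where
  "configs n N = {M. set_mset M \<subseteq> \<C> \<and> size M = N \<and> (\<Sum>x\<in>#M. sz x) = n}"

text \<open>Minimal members have no excess, so the larger ones carry all of
  \<open>n - m * N\<close>. The subtraction is truncated: for m * N > n there is no configuration,
  yet the empty core remains, whence the hypothesis \<open>m * N \<le> n\<close> below.\<close>

definition cores :: "nat \<Rightarrow> nat \<Rightarrow> 'a multiset set" where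
  "cores n N = {M \<in> msets (n - m * N). size M \<le> N}"

lemma finite_cores: "finite (cores n N)"
  by (simp add: cores_def finite_msets)

lemma sum_sz: "set_mset M \<subseteq> \<C> \<Longrightarrow> (\<Sum>x\<in>#M. sz x) = m * size M + (\<Sum>x\<in>#M. excess x)"
proof (induction M)
  case (add x M)
  then show ?case using min_le[of x] by (simp add: excess_def)
qed simp

lemma minimalD: "x \<in> minimal \<Longrightarrow> x \<in> \<C> \<and> sz x = m"
  and largerD: "x \<in> larger \<Longrightarrow> x \<in> \<C> \<and> m < sz x"
  by (auto simp: minimal_def larger_def)

text \<open>Separating the members larger than m from those of size m is a bijection. Once the core
  M is fixed, any multiset of \<open>N - size M\<close> minimal elements completes it, since the
  total size is then automatically n.\<close>

lemma sum_configs: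
  fixes g :: "'a multiset \<Rightarrow> real"
  assumes n: "m * N \<le> n"
  shows "(\<Sum>M\<in>configs n N. g M) =
    (\<Sum>M\<in>cores n N. \<Sum>M0\<in>multisets_of_size minimal (N - size M). g (M0 + M))"
proof -
  let ?S = "SIGMA M:cores n N. multisets_of_size minimal (N - size M)"
  have "(\<Sum>M\<in>configs n N. g M) = (\<Sum>(M, M0)\<in>?S. g (M0 + M))"
  proof (rule sum.reindex_bij_witness[of _ "\<lambda>(M, M0). M0 + M"
        "\<lambda>M. (filter_mset (\<lambda>x. m < sz x) M, filter_mset (\<lambda>x. \<not> m < sz x) M)"])
    fix M assume M: "M \<in> configs n N"
    let ?M' = "filter_mset (\<lambda>x. m < sz x) M" and ?M0 = "filter_mset (\<lambda>x. \<not> m < sz x) M"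
    have part: "M = ?M' + ?M0" by (rule multiset_partition)
    then show "(case (?M', ?M0) of (M, M0) \<Rightarrow> M0 + M) = M"
      by (simp add: add.commute)
    then show "(case (?M', ?M0) of (M, M0) \<Rightarrow> g (M0 + M)) = g M" by simp
    have MC: "set_mset M \<subseteq> \<C>" "size M = N" "(\<Sum>x\<in>#M. sz x) = n"
      using M by (auto simp: configs_def)
    have M0: "set_mset ?M0 \<subseteq> minimal"
      using MC min_le by (force simp: minimal_def)
    have "(\<Sum>x\<in>#?M0. excess x) = 0"
      using M0 by (auto simp: minimal_def excess_def)
    moreover have "(\<Sum>x\<in>#M. excess x) = (\<Sum>x\<in>#?M'. excess x) + (\<Sum>x\<in>#?M0. excess x)"
      by (metis part image_mset_union sum_mset.union)
    ultimately have "(\<Sum>x\<in>#?M'. excess x) = n - m * N"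
      using sum_sz[OF MC(1)] MC by simp
    moreover have sz: "size M = size ?M' + size ?M0" by (metis part size_union)
    moreover have "set_mset ?M' \<subseteq> larger" using MC(1) by (auto simp: larger_def)
    ultimately have "?M' \<in> cores n N"
      using MC(2) by (simp add: cores_def msets_def)
    moreover have "?M0 \<in> multisets_of_size minimal (N - size ?M')"
      using M0 sz MC by (simp add: multisets_of_size_def)
    ultimately show "(?M', ?M0) \<in> ?S" by simp
  next
    fix z assume "z \<in> ?S"
    then obtain M M0 where z: "z = (M, M0)" and M: "M \<in> cores n N"
      and M0: "M0 \<in> multisets_of_size minimal (N - size M)" by auto
    have "set_mset M \<subseteq> larger" and sM: "size M \<le> N" "(\<Sum>x\<in>#M. excess x) = n - m * N"
      using M by (auto simp: cores_def msets_def)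
    then have L: "x \<in> \<C> \<and> m < sz x" if "x \<in># M" for x using that largerD by blast
    have sM0: "size M0 = N - size M" and mM0: "set_mset M0 \<subseteq> minimal"
      using M0 by (auto simp: multisets_of_size_def)
    then have L0: "x \<in> \<C> \<and> sz x = m" if "x \<in># M0" for x using that minimalD by blast
    have "filter_mset (\<lambda>x. m < sz x) M = M" "filter_mset (\<lambda>x. \<not> m < sz x) M0 = M0"
      using L L0 by (auto intro!: filter_mset_all)
    moreover have "filter_mset (\<lambda>x. m < sz x) M0 = {#}" "filter_mset (\<lambda>x. \<not> m < sz x) M = {#}"
      using L L0 by (auto intro!: filter_mset_none)
    ultimately show "(filter_mset (\<lambda>x. m < sz x) (case z of (M, M0) \<Rightarrow> M0 + M),
         filter_mset (\<lambda>x. \<not> m < sz x) (case z of (M, M0) \<Rightarrow> M0 + M)) = z"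
      by (simp add: z)
    have C: "set_mset (M0 + M) \<subseteq> \<C>" using L L0 by auto
    have "(\<Sum>x\<in>#M0. excess x) = 0" using L0 by (auto simp: excess_def)
    then have "(\<Sum>x\<in>#M0 + M. sz x) = m * N + (n - m * N)"
      using sum_sz[OF C] sM sM0 by simp
    then show "(case z of (M, M0) \<Rightarrow> M0 + M) \<in> configs n N"
      using C sM sM0 n by (simp add: z configs_def)
  qed
  also have "\<dots> = (\<Sum>M\<in>cores n N. \<Sum>M0\<in>multisets_of_size minimal (N - size M). g (M0 + M))"
    using finite_cores finite_minimal by (subst sum.Sigma) auto
  finally show ?thesis .
qed

abbreviation fillings :: "nat \<Rightarrow> real" where
  "fillings j \<equiv> real (card (multisets_of_size minimal j))"

lemma card_configs:
  assumes "m * N \<le> n"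
  shows "real (card (configs n N)) = (\<Sum>M\<in>cores n N. fillings (N - size M))"
  using sum_configs[OF assms, of "\<lambda>_. 1"] by simp

end

section \<open>Averages of an additive statistic over uniform configurations\<close>

locale component_statistic = component_class +
  fixes f :: "'a \<Rightarrow> real"
  assumes f_nonneg: "x \<in> \<C> \<Longrightarrow> 0 \<le> f x" and f_le: "x \<in> \<C> \<Longrightarrow> f x \<le> sz x"
begin

text \<open>Normalised by the total size of the elements of size k, so that it becomes a rooting
  probability when f counts favourable roots. It is 0 for sizes that do not occur.\<close>

definition mean :: "nat \<Rightarrow> real" where
  "mean k = (\<Sum>x\<in>{x \<in> \<C>. sz x = k}. f x) / (k * card {x \<in> \<C>. sz x = k})"

text \<open>The mean of the statistic over all completions of the core \<open>M\<close> to \<open>N\<close> components.\<close>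

definition core_mean :: "nat \<Rightarrow> 'a multiset \<Rightarrow> real" where
  "core_mean N M = real (N - size M) * m * mean m + (\<Sum>x\<in>#M. f x)"

lemma sum_f_le: "(\<Sum>x\<in>{x \<in> \<C>. sz x = k}. f x) \<le> k * card {x \<in> \<C>. sz x = k}"
proof -
  have "(\<Sum>x\<in>{x \<in> \<C>. sz x = k}. f x) \<le> (\<Sum>x\<in>{x \<in> \<C>. sz x = k}. real k)"
    using f_le by (intro sum_mono) auto
  then show ?thesis by (simp add: mult.commute)
qed

lemma mean_nonneg: "0 \<le> mean k"
  unfolding mean_def using f_nonneg by (intro divide_nonneg_nonneg sum_nonneg) auto

lemma mean_le_1: "mean k \<le> 1"
  unfolding mean_def using sum_f_le[of k] by (cases "k * card {x \<in> \<C>. sz x = k} = 0") (auto simp: divide_le_eq_1)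

lemma sum_f_eq: "0 < k \<Longrightarrow> (\<Sum>x\<in>{x \<in> \<C>. sz x = k}. f x) = k * card {x \<in> \<C>. sz x = k} * mean k"
proof (cases "{x \<in> \<C>. sz x = k} = {}")
  case True
  show ?thesis unfolding True by simp
next
  case False
  then have "card {x \<in> \<C>. sz x = k} \<noteq> 0" using finite_sz[of k] by simp
  then show "0 < k \<Longrightarrow> ?thesis" by (simp add: mean_def)
qed

lemma sum_mset_f:
  assumes "set_mset M \<subseteq> \<C>"
  shows "0 \<le> (\<Sum>x\<in>#M. f x)" "(\<Sum>x\<in>#M. f x) \<le> (\<Sum>x\<in>#M. sz x)"
  using assms
proof (induction M)
  case (add x M)
  { case 1 then show ?case using add f_nonneg[of x] by simp }
  { case 2 then show ?case using add f_le[of x] by simp }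
qed simp_all

lemma core_mean_bounds:
  assumes "M \<in> cores n N" "m * N \<le> n"
  shows "0 \<le> core_mean N M" "core_mean N M \<le> n"
proof -
  have M: "set_mset M \<subseteq> \<C>" "(\<Sum>x\<in>#M. excess x) = n - m * N" "size M \<le> N"
    using assms(1) largerD by (auto simp: cores_def msets_def)
  show "0 \<le> core_mean N M"
    using sum_mset_f[OF M(1)] mean_nonneg by (simp add: core_mean_def)
  have "real (N - size M) * m * mean m \<le> real (N - size M) * m * 1"
    using mean_le_1 by (intro mult_left_mono) auto
  moreover have "(\<Sum>x\<in>#M. f x) \<le> real (m * size M + (n - m * N))"
    using sum_mset_f(2)[OF M(1)] sum_sz[OF M(1)] M(2) by simp
  moreover have "(N - size M) * m + (m * size M + (n - m * N)) = n"
    using M(3) assms(2) by (simp add: algebra_simps)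
  then have "real (N - size M) * real m + real (m * size M + (n - m * N)) = real n"
    by (metis of_nat_add of_nat_mult)
  ultimately show "core_mean N M \<le> n" by (simp add: core_mean_def)
qed

text \<open>For a fixed core the completions are all multisets of minimal elements of one size.
  There each element has the same average multiplicity, so f enters only through its mean over
  minimal elements.\<close>

lemma sum_statistic_configs:
  assumes "m * N \<le> n"
  shows "(\<Sum>M\<in>configs n N. \<Sum>x\<in>#M. f x) = (\<Sum>M\<in>cores n N. fillings (N - size M) * core_mean N M)"
  unfolding sum_configs[OF assms]
proof (rule sum.cong[OF refl])
  fix M assume "M \<in> cores n N"
  let ?j = "N - size M"
  let ?W = "multisets_of_size minimal ?j"
  have "card minimal * (\<Sum>M0\<in>?W. \<Sum>x\<in>#M0. f x) = real (?j * card ?W) * (\<Sum>x\<in>minimal. f x)"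
    using sum_multisets_of_size[OF finite_minimal] by simp
  also have "(\<Sum>x\<in>minimal. f x) = m * card minimal * mean m"
    unfolding minimal_def by (rule sum_f_eq[OF min_pos])
  finally have "real (card minimal) * (\<Sum>M0\<in>?W. \<Sum>x\<in>#M0. f x)
      = real (card minimal) * (fillings ?j * (real ?j * m * mean m))"
    by (simp only: of_nat_mult mult_ac)
  then have "(\<Sum>M0\<in>?W. \<Sum>x\<in>#M0. f x) = fillings ?j * (real ?j * m * mean m)"
    using minimal_nonempty finite_minimal by simp
  then show "(\<Sum>M0\<in>?W. \<Sum>x\<in>#M0 + M. f x) = fillings ?j * core_mean N M"
    by (simp add: core_mean_def sum.distrib distrib_left)
qed

text \<open>The limit statement for fixed n and N, with its asymptotic inputs as hypotheses. One
  half of the final 2\<epsilon> comes from cores without a giant, where the deviation may be as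
  large as n but the cores are few; the other half comes from cores with a giant, where the mean
  over all giants of one size is close to \<open>n * \<theta>\<close>.\<close>

lemma deviation_bound:
  fixes \<theta> \<epsilon> :: real
  defines "s \<equiv> \<lambda>n N. n - m * N"
  assumes n: "m * N \<le> n" and \<theta>: "0 \<le> \<theta>" "\<theta> \<le> 1" and "0 < \<epsilon>"
    and few: "card {M \<in> msets (s n N). \<forall>x\<in>#M. excess x < s n N - K}
               \<le> \<epsilon> / card minimal * card (level (s n N))"
    and lev: "0 < card (level (s n N))" and N: "K + 2 \<le> N" and K: "2 * K < s n N"
    and giant: "\<And>r R. r \<le> K \<Longrightarrow> R \<in> msets r \<Longrightarrow>
       \<bar>real (N - 1 - size R) * m * mean m + (\<Sum>x\<in>#R. f x)
          + real (s n N - r + m) * mean (s n N - r + m) - n * \<theta>\<bar> \<le> \<epsilon> * n"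
  shows "0 < card (configs n N)"
    and "\<bar>(\<Sum>M\<in>configs n N. \<Sum>x\<in>#M. f x) - n * \<theta> * card (configs n N)\<bar>
           \<le> 2 * \<epsilon> * n * card (configs n N)"
proof -
  define t where "t = s n N"
  define Z where "Z = (\<Sum>M\<in>cores n N. fillings (N - size M))"
  have cores: "cores n N = {M \<in> msets t. size M \<le> N}" by (simp add: cores_def t_def s_def)
  have t: "2 * K < t" using K by (simp add: t_def)
  have Z: "real (card (configs n N)) = Z" using card_configs[OF n] by (simp add: Z_def)
  \<comment> \<open>Cores consisting of a single giant already give the lower bound on
    \<open>Z\<close> against which the cores without a giant are measured.\<close>
  have "(\<lambda>x. {#x#}) ` level t \<subseteq> cores n N"
    using N by (auto simp: cores msets_def level_def)
  then have "(\<Sum>M\<in>(\<lambda>x. {#x#}) ` level t. fillings (N - size M)) \<le> Z"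
    unfolding Z_def using finite_cores by (intro sum_mono2) auto
  then have Z_ge: "card (level t) * fillings (N - 1) \<le> Z"
    by (subst (asm) sum.reindex) (auto simp: inj_on_def)
  have "0 < card (multisets_of_size minimal 0)" by simp
  then have fpos: "0 < fillings j" for j
    using card_multisets_of_size_mono[OF finite_minimal minimal_nonempty, of 0 j] by simp
  have Z0: "0 < Z" using Z_ge fpos[of "N - 1"] lev by (smt (verit) t_def mult_pos_pos of_nat_0_less_iff)
  then show "0 < card (configs n N)" using Z by simp

  define y where "y M = fillings (N - size M) * (core_mean N M - n * \<theta>)" for M
  define B where "B = {M \<in> cores n N. \<forall>x\<in>#M. excess x < t - K}"
  have diff: "(\<Sum>M\<in>configs n N. \<Sum>x\<in>#M. f x) - n * \<theta> * Z = sum y (cores n N)"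
    unfolding sum_statistic_configs[OF n] y_def Z_def sum_distrib_left
    by (simp add: sum_subtractf[symmetric] algebra_simps)

  have "\<bar>sum y B\<bar> \<le> (\<Sum>M\<in>B. \<bar>y M\<bar>)" by (rule sum_abs)
  also have "\<dots> \<le> (\<Sum>M\<in>B. fillings N * n)"
  proof (rule sum_mono)
    fix M assume "M \<in> B"
    then have M: "M \<in> cores n N" by (simp add: B_def)
    have "0 \<le> n * \<theta>" "n * \<theta> \<le> n" using \<theta> by (simp_all add: mult_left_le)
    then have "\<bar>core_mean N M - n * \<theta>\<bar> \<le> n"
      using core_mean_bounds[OF M n] by linarith
    moreover have "fillings (N - size M) \<le> fillings N"
      using card_multisets_of_size_mono[OF finite_minimal minimal_nonempty] by simp
    ultimately show "\<bar>y M\<bar> \<le> fillings N * n"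
      unfolding y_def abs_mult by (intro mult_mono) auto
  qed
  also have "\<dots> = n * (fillings N * card B)" by simp
  \<comment> \<open>Passing from \<open>fillings N\<close> to \<open>fillings (N - 1)\<close> costs
    the factor \<open>card minimal\<close>, which the denominator in \<open>few\<close>
    cancels.\<close>
  also have "\<dots> \<le> n * ((card minimal * fillings (N - 1)) * (\<epsilon> / card minimal * card (level t)))"
  proof (intro mult_left_mono mult_mono)
    have "card (multisets_of_size minimal (Suc (N - 1))) \<le> card minimal * card (multisets_of_size minimal (N - 1))"
      by (rule card_multisets_of_size_Suc_le[OF finite_minimal])
    moreover have "Suc (N - 1) = N" using N by simp
    ultimately have "card (multisets_of_size minimal N) \<le> card minimal * card (multisets_of_size minimal (N - 1))" by simp
    then show "fillings N \<le> card minimal * fillings (N - 1)" by (metis of_nat_mono of_nat_mult)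
    have "card B \<le> card {M \<in> msets t. \<forall>x\<in>#M. excess x < t - K}"
      using finite_msets by (intro card_mono) (auto simp: B_def cores)
    also have "real \<dots> \<le> \<epsilon> / card minimal * card (level t)"
      using few by (simp add: t_def)
    finally show "real (card B) \<le> \<epsilon> / card minimal * card (level t)" by simp
  qed auto
  also have "\<dots> = n * \<epsilon> * (card (level t) * fillings (N - 1))"
    using minimal_nonempty finite_minimal by simp
  also have "\<dots> \<le> n * \<epsilon> * Z" using Z_ge \<open>0 < \<epsilon>\<close> by (intro mult_left_mono) auto
  finally have bad: "\<bar>sum y B\<bar> \<le> n * \<epsilon> * Z" .

  let ?R = "\<Union>r\<le>K. msets r"
  let ?e = "\<lambda>R. \<Sum>x\<in>#R. excess x"
  have eR: "?e R \<le> K" "R \<in> msets (?e R)" "set_mset R \<subseteq> larger" "size R \<le> K" if "R \<in> ?R" for R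
    using that size_le_sum[of R] by (auto simp: msets_def)
  have good: "(\<Sum>M\<in>cores n N - B. g M) = (\<Sum>R\<in>?R. \<Sum>x\<in>level (t - ?e R). g (add_mset x R))"
    for g :: "'a multiset \<Rightarrow> real"
  proof -
    let ?S = "SIGMA R:?R. level (t - ?e R)"
    let ?c = "\<lambda>(R, x). add_mset x R"
    have giantS: "t - K \<le> excess x" "x \<in> larger" "excess x = t - ?e R" if "(R, x) \<in> ?S" for R x
      using that eR[of R] by (auto simp: level_def)
    \<comment> \<open>The giant is unique: a remainder has total excess at most K, whereas the giant
      has at least t - K, which exceeds K because 2 * K < t.\<close>
    have "inj_on ?c ?S"
    proof (rule inj_onI)
      fix z z' assume z: "z \<in> ?S" "z' \<in> ?S" and eq: "?c z = ?c z'"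
      obtain R x R' x' where [simp]: "z = (R, x)" "z' = (R', x')" by (cases z; cases z') auto
      have "x = x'"
      proof (rule ccontr)
        assume "x \<noteq> x'"
        then have "x \<in># R'" using eq by (metis \<open>z = (R, x)\<close> \<open>z' = (R', x')\<close> case_prod_conv insert_noteq_member)
        then have "excess x \<le> K" using weight_le_sum[of x R'] eR(1)[of R'] z(2) by auto
        then show False using giantS(1)[of R x] z(1) t by simp
      qed
      then show "z = z'" using eq by simp
    qed
    moreover have "?c ` ?S = cores n N - B"
    proof (intro equalityI subsetI)
      fix M assume "M \<in> ?c ` ?S"
      then obtain R x where RS: "(R, x) \<in> ?S" and M: "M = add_mset x R" by auto
      have R: "R \<in> ?R" using RS by auto
      show "M \<in> cores n N - B"
        using giantS[OF RS] eR[OF R] t N by (auto simp: M B_def cores msets_def)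
    next
      fix M assume M: "M \<in> cores n N - B"
      then obtain x where x: "x \<in># M" "t - K \<le> excess x" by (auto simp: B_def not_less)
      define R where "R = M - {#x#}"
      have MR: "M = add_mset x R" using x by (simp add: R_def)
      have Ml: "set_mset M \<subseteq> larger" "?e M = t" using M by (auto simp: cores msets_def)
      have "?e R + excess x = t" using Ml(2) by (simp add: MR)
      then have "(R, x) \<in> ?S" using x Ml(1) t by (auto simp: level_def msets_def MR)
      then show "M \<in> ?c ` ?S" using MR by force
    qed
    ultimately have "(\<Sum>M\<in>cores n N - B. g M) = (\<Sum>z\<in>?S. g (?c z))"
      by (metis (no_types, lifting) sum.reindex_cong)
    also have "\<dots> = (\<Sum>(R, x)\<in>?S. g (add_mset x R))" by (simp add: case_prod_unfold)
    also have "\<dots> = (\<Sum>R\<in>?R. \<Sum>x\<in>level (t - ?e R). g (add_mset x R))"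
      using finite_msets finite_level by (subst sum.Sigma) (auto simp: level_def)
    finally show ?thesis .
  qed
  \<comment> \<open>The absolute value stays outside the sum over giants: what is controlled is
    their mean over a level, not the deviation of a single giant.\<close>
  have "\<bar>sum y (cores n N - B)\<bar> \<le> (\<Sum>R\<in>?R. \<bar>\<Sum>x\<in>level (t - ?e R). y (add_mset x R)\<bar>)"
    unfolding good by (rule sum_abs)
  also have "\<dots> \<le> (\<Sum>R\<in>?R. \<Sum>x\<in>level (t - ?e R). n * \<epsilon> * fillings (N - size (add_mset x R)))"
  proof (rule sum_mono)
    fix R assume R: "R \<in> ?R"
    define r where "r = ?e R"
    let ?w = "fillings (N - 1 - size R)" and ?L = "level (t - r)"
    let ?d = "real (N - 1 - size R) * m * mean m + (\<Sum>x\<in>#R. f x)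
          + real (t - r + m) * mean (t - r + m) - n * \<theta>"
    have r: "r \<le> K" "R \<in> msets r" using eR[OF R] by (auto simp: r_def)
    have "(\<Sum>x\<in>?L. f x) = real (t - r + m) * card ?L * mean (t - r + m)"
      using level_eq[of "t - r"] sum_f_eq[of "t - r + m"] r t by simp
    moreover have "(\<Sum>x\<in>?L. y (add_mset x R)) = ?w * ((\<Sum>x\<in>?L. f x) + card ?L *
        (real (N - 1 - size R) * m * mean m + (\<Sum>x\<in>#R. f x) - n * \<theta>))"
    proof -
      have "y (add_mset x R) = ?w * (f x +
          (real (N - 1 - size R) * m * mean m + (\<Sum>x\<in>#R. f x) - n * \<theta>))" for x
        by (simp add: y_def core_mean_def)
      then show ?thesis by (simp add: sum_distrib_left[symmetric] sum.distrib)
    qed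
    ultimately have "(\<Sum>x\<in>?L. y (add_mset x R)) = ?w * (card ?L * ?d)"
      by (simp add: algebra_simps)
    then have "\<bar>\<Sum>x\<in>?L. y (add_mset x R)\<bar> = ?w * (card ?L * \<bar>?d\<bar>)"
      by (simp add: abs_mult)
    also have "\<dots> \<le> ?w * (card ?L * (\<epsilon> * n))"
      using giant[OF r] by (intro mult_left_mono) (auto simp: t_def)
    also have "\<dots> = (\<Sum>x\<in>?L. n * \<epsilon> * fillings (N - size (add_mset x R)))"
      by simp
    finally show "\<bar>\<Sum>x\<in>level (t - ?e R). y (add_mset x R)\<bar>
        \<le> (\<Sum>x\<in>level (t - ?e R). n * \<epsilon> * fillings (N - size (add_mset x R)))"
      by (simp add: r_def)
  qed
  also have "\<dots> = (\<Sum>M\<in>cores n N - B. n * \<epsilon> * fillings (N - size M))"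
    by (rule good[symmetric])
  also have "\<dots> = n * \<epsilon> * (\<Sum>M\<in>cores n N - B. fillings (N - size M))"
    by (simp add: sum_distrib_left)
  also have "\<dots> \<le> n * \<epsilon> * Z"
    unfolding Z_def using finite_cores \<open>0 < \<epsilon>\<close> by (intro mult_left_mono sum_mono2) auto
  finally have "\<bar>sum y (cores n N - B)\<bar> \<le> n * \<epsilon> * Z" .
  moreover have "sum y (cores n N) = sum y (cores n N - B) + sum y B"
    using finite_cores by (intro sum.subset_diff) (auto simp: B_def)
  ultimately have "\<bar>sum y (cores n N)\<bar> \<le> 2 * \<epsilon> * n * Z" using bad by (simp add: mult_ac)
  then show "\<bar>(\<Sum>M\<in>configs n N. \<Sum>x\<in>#M. f x) - n * \<theta> * card (configs n N)\<bar>
           \<le> 2 * \<epsilon> * n * card (configs n N)"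
    by (simp add: diff Z)
qed

text \<open>Once K is fixed from \<epsilon>, finitely many remainders have excess at most K. For
  each of them about m * N of the n vertices lie in minimal components and about n - m * N in the
  giant, whose size tends to infinity because lam < 1.\<close>

lemma mean_limit:
  fixes n N :: "nat \<Rightarrow> nat"
  assumes sub: "subexponential (\<lambda>k. real (card {x \<in> \<C>. sz x = k})) \<rho>"
    and q: "mean \<longlonglongrightarrow> q" and lam: "0 \<le> lam" "lam < 1"
    and n: "filterlim n at_top sequentially" and N: "filterlim N at_top sequentially"
    and ratio: "(\<lambda>i. real m * real (N i) / real (n i)) \<longlonglongrightarrow> lam"
  shows "\<forall>\<^sub>F i in sequentially. 0 < card (configs (n i) (N i))"
    and "(\<lambda>i. (\<Sum>M\<in>configs (n i) (N i). \<Sum>x\<in>#M. f x) / (n i * card (configs (n i) (N i))))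
           \<longlonglongrightarrow> (1 - lam) * q + lam * mean m"
proof -
  let ?c = "\<lambda>k. card {x \<in> \<C>. sz x = k}"
  let ?s = "\<lambda>i. n i - m * N i"
  define \<theta> where "\<theta> = (1 - lam) * q + lam * mean m"
  define b where "b k = max 1 (real (?c (k + m)))" for k
  have b: "subexponential_weights b \<rho>"
    unfolding b_def by (rule subexponential_weights_shift[OF sub])
  have q01: "0 \<le> q" "q \<le> 1"
    using LIMSEQ_le_const[OF q] LIMSEQ_le_const2[OF q] mean_nonneg mean_le_1 by blast+
  have \<theta>: "0 \<le> \<theta>" "\<theta> \<le> 1"
    unfolding \<theta>_def using q01 lam mean_nonneg[of m] mean_le_1[of m]
    by (auto intro!: convex_bound_le add_nonneg_nonneg)
  have le_b: "real (card (level k)) \<le> b k" for k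
    unfolding level_def excess_level b_def by (simp add: le_max_iff_disj)
  have "\<forall>\<^sub>F k in sequentially. 0 < real (?c k)" using sub by (simp add: subexponential_def)
  then have "\<forall>\<^sub>F k in sequentially. 0 < real (?c (k + m))"
    by (rule eventually_sequentially_seg[THEN iffD2])
  then have level_b: "\<forall>\<^sub>F k in sequentially. 0 < card (level k) \<and> real (card (level k)) = b k"
    using eventually_gt_at_top[of 0] by eventually_elim (auto simp: b_def level_eq)
  have n0: "\<forall>\<^sub>F i in sequentially. 0 < n i"
    using filterlim_at_top[THEN iffD1, OF n, rule_format, of 1] by (auto elim: eventually_mono)
  have inv: "(\<lambda>i. c / real (n i)) \<longlonglongrightarrow> 0" for c
    using n by (intro tendsto_divide_0[OF tendsto_const] filterlim_at_top_imp_at_infinity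
        filterlim_compose[OF filterlim_real_sequentially])
  \<comment> \<open>The number 1 - \<kappa> lies halfway between lam and 1, so m * N / n is
    eventually below it and the excess is at least \<kappa> * n.\<close>
  define \<kappa> where "\<kappa> = (1 - lam) / 2"
  have \<kappa>: "0 < \<kappa>" using lam by (simp add: \<kappa>_def)
  have "\<forall>\<^sub>F i in sequentially. real m * real (N i) / real (n i) < 1 - \<kappa>"
    using lam by (intro order_tendstoD(2)[OF ratio]) (simp add: \<kappa>_def field_simps)
  then have sn: "\<forall>\<^sub>F i in sequentially. m * N i \<le> n i \<and> \<kappa> * n i \<le> real (?s i)"
    using n0
  proof eventually_elim
    case (elim i)
    then have "real m * real (N i) < (1 - \<kappa>) * n i" by (simp add: pos_divide_less_eq)
    then have "real (m * N i) < n i - \<kappa> * n i" by (simp add: algebra_simps)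
    moreover have "0 \<le> \<kappa> * n i" using \<kappa> by simp
    ultimately have "m * N i \<le> n i" "\<kappa> * n i \<le> real (n i) - real (m * N i)" by linarith+
    then show ?case by (simp add: of_nat_diff)
  qed
  have s: "filterlim ?s at_top sequentially"
    unfolding filterlim_at_top
  proof
    fix Q :: nat
    have "\<forall>\<^sub>F i in sequentially. nat \<lceil>Q / \<kappa>\<rceil> \<le> n i"
      by (rule filterlim_at_top[THEN iffD1, OF n, rule_format])
    with sn show "\<forall>\<^sub>F i in sequentially. Q \<le> ?s i"
    proof eventually_elim
      case (elim i)
      have "Q / \<kappa> \<le> n i" using elim by linarith
      then have "Q \<le> \<kappa> * n i" using \<kappa> by (simp add: pos_divide_le_eq mult.commute)
      then show ?case using elim by linarith
    qed
  qed
  \<comment> \<open>Here k, r and c stand for the size, the excess and the statistic of a fixed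
    remainder; their contributions vanish after division by n, which leaves the weights lam and 1 -
    lam.\<close>
  have giant_lim: "(\<lambda>i. (real (N i - 1 - k) * m * mean m + c
          + real (?s i - r + m) * mean (?s i - r + m)) / n i) \<longlonglongrightarrow> \<theta>" for k r c
  proof -
    have "filterlim (\<lambda>i. ?s i - r + m) sequentially sequentially"
      by (rule filterlim_compose[OF filterlim_add_const_nat_at_top
            filterlim_compose[OF filterlim_minus_const_nat_at_top s]])
    then have mq: "(\<lambda>i. mean (?s i - r + m)) \<longlonglongrightarrow> q"
      by (rule filterlim_compose[OF q])
    have "(\<lambda>i. (real m * N i / n i - (real m * (1 + k)) / n i) * mean m + c / n i
        + (1 - real m * N i / n i + (real m - r) / n i) * mean (?s i - r + m))
      \<longlonglongrightarrow> (lam - 0) * mean m + 0 + (1 - lam + 0) * q"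
      by (intro tendsto_intros ratio inv mq)
    moreover have "\<forall>\<^sub>F i in sequentially.
        (real m * N i / n i - (real m * (1 + k)) / n i) * mean m + c / n i
        + (1 - real m * N i / n i + (real m - r) / n i) * mean (?s i - r + m)
      = (real (N i - 1 - k) * m * mean m + c
          + real (?s i - r + m) * mean (?s i - r + m)) / n i"
      using sn n0 filterlim_at_top[THEN iffD1, OF s, rule_format, of r]
        filterlim_at_top[THEN iffD1, OF N, rule_format, of "1 + k"]
    proof eventually_elim
      case (elim i)
      have "?s i - r + m + m * N i + r = n i + m" using elim by linarith
      then have "real (?s i - r + m) + real (m * N i) + real r = real (n i) + real m"
        by (metis of_nat_add)
      then have s_eq: "real (?s i - r + m) = real (n i) - real m * real (N i) - real r + real m" by simp
      have N_eq: "real (N i - 1 - k) = real (N i) - (1 + real k)"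
        using elim by (simp add: of_nat_diff)
      show ?case unfolding s_eq N_eq using elim(2) by (simp add: field_simps)
    qed
    ultimately show ?thesis
      by (auto simp: \<theta>_def add.commute elim: Lim_transform_eventually)
  qed
  have main: "\<forall>\<^sub>F i in sequentially. 0 < n i \<and> 0 < card (configs (n i) (N i)) \<and>
      \<bar>(\<Sum>M\<in>configs (n i) (N i). \<Sum>x\<in>#M. f x) - n i * \<theta> * card (configs (n i) (N i))\<bar>
           \<le> 2 * \<epsilon> * n i * card (configs (n i) (N i))" if "0 < \<epsilon>" for \<epsilon> :: real
  proof -
    have "0 < \<epsilon> / card minimal"
      using that minimal_nonempty finite_minimal by (simp add: card_gt_0_iff)
    then obtain K where K: "\<forall>\<^sub>F s in sequentially.
        real (card {M \<in> msets s. \<forall>x\<in>#M. excess x < s - K}) \<le> \<epsilon> / card minimal * b s"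
      using few_without_giant[OF b le_b] by blast
    have few: "\<forall>\<^sub>F i in sequentially. real (card {M \<in> msets (?s i). \<forall>x\<in>#M. excess x < ?s i - K})
          \<le> \<epsilon> / card minimal * b (?s i) \<and> 0 < card (level (?s i))
          \<and> real (card (level (?s i))) = b (?s i)"
      using filterlim_iff[THEN iffD1, OF s] eventually_conj[OF K level_b] by blast
    let ?P = "\<lambda>R i. \<bar>real (N i - 1 - size R) * m * mean m + (\<Sum>x\<in>#R. f x)
          + real (?s i - (\<Sum>x\<in>#R. excess x) + m) * mean (?s i - (\<Sum>x\<in>#R. excess x) + m)
          - n i * \<theta>\<bar> \<le> \<epsilon> * n i"
    have "\<forall>\<^sub>F i in sequentially. ?P R i" for R
      using tendstoD[OF giant_lim[of "size R" "\<Sum>x\<in>#R. f x" "\<Sum>x\<in>#R. excess x"] that] n0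
    proof eventually_elim
      case (elim i)
      let ?x = "real (N i - 1 - size R) * m * mean m + (\<Sum>x\<in>#R. f x)
          + real (?s i - (\<Sum>x\<in>#R. excess x) + m) * mean (?s i - (\<Sum>x\<in>#R. excess x) + m)"
      have "\<bar>?x / n i - \<theta>\<bar> \<le> \<epsilon>" using elim by (simp add: dist_real_def)
      then have "\<bar>?x / n i - \<theta>\<bar> * n i \<le> \<epsilon> * n i" by (intro mult_right_mono) auto
      moreover have "\<bar>?x / n i - \<theta>\<bar> * n i = \<bar>(?x / n i - \<theta>) * n i\<bar>" by (simp add: abs_mult)
      moreover have "(x / n i - \<theta>) * n i = x - n i * \<theta>" for x :: real
        using elim(2) by (simp add: field_simps)
      ultimately show ?case by simp
    qed
    \<comment> \<open>Finiteness of the set of remainders turns the separate limits into one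
      threshold valid for all of them.\<close>
    then have giant: "\<forall>\<^sub>F i in sequentially. \<forall>R\<in>(\<Union>r\<le>K. msets r). ?P R i"
      using finite_msets by (subst eventually_ball_finite_distrib) auto
    show ?thesis
      using few giant sn n0 filterlim_at_top[THEN iffD1, OF s, rule_format, of "2 * K + 1"]
        filterlim_at_top[THEN iffD1, OF N, rule_format, of "K + 2"]
    proof eventually_elim
      case (elim i)
      have g: "\<bar>real (N i - 1 - size R) * m * mean m + (\<Sum>x\<in>#R. f x)
          + real (?s i - r + m) * mean (?s i - r + m) - n i * \<theta>\<bar> \<le> \<epsilon> * n i"
        if "r \<le> K" "R \<in> msets r" for r R
      proof -
        have "R \<in> (\<Union>r\<le>K. msets r)" and "r = (\<Sum>x\<in>#R. excess x)"
          using that by (auto simp: msets_def)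
        then show ?thesis using elim(2) by blast
      qed
      have "card {M \<in> msets (?s i). \<forall>x\<in>#M. excess x < ?s i - K}
               \<le> \<epsilon> / card minimal * card (level (?s i))"
        "0 < card (level (?s i))" "m * N i \<le> n i" "2 * K < ?s i" "K + 2 \<le> N i"
        using elim by auto
      note d = deviation_bound[OF this(3) \<theta> that this(1,2,5,4)]
      show ?case using d[OF g] elim by blast
    qed
  qed
  show "\<forall>\<^sub>F i in sequentially. 0 < card (configs (n i) (N i))"
    using main[of 1] by (auto elim: eventually_mono)
  have "(\<lambda>i. (\<Sum>M\<in>configs (n i) (N i). \<Sum>x\<in>#M. f x) / (n i * card (configs (n i) (N i)))) \<longlonglongrightarrow> \<theta>"
  proof (rule tendstoI)
    fix \<epsilon> :: real assume "0 < \<epsilon>"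
    then have "0 < \<epsilon> / 3" by simp
    from main[OF this] show "\<forall>\<^sub>F i in sequentially.
        dist ((\<Sum>M\<in>configs (n i) (N i). \<Sum>x\<in>#M. f x) / (n i * card (configs (n i) (N i)))) \<theta> < \<epsilon>"
    proof eventually_elim
      case (elim i)
      define F where "F = (\<Sum>M\<in>configs (n i) (N i). \<Sum>x\<in>#M. f x)"
      define Q where "Q = real (n i * card (configs (n i) (N i)))"
      have Q: "0 < Q" using elim by (simp add: Q_def)
      have "\<bar>F - \<theta> * Q\<bar> \<le> 2 * (\<epsilon> / 3) * Q" using elim by (simp add: F_def Q_def mult_ac)
      moreover have "F - \<theta> * Q = (F / Q - \<theta>) * Q" using Q by (simp add: field_simps)
      ultimately have "\<bar>F / Q - \<theta>\<bar> * Q \<le> 2 * (\<epsilon> / 3) * Q" using Q by (simp add: abs_mult)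
      then have "\<bar>F / Q - \<theta>\<bar> \<le> 2 * (\<epsilon> / 3)" using Q by simp
      also have "\<dots> < \<epsilon>" using \<open>0 < \<epsilon>\<close> by simp
      finally show ?case by (simp add: dist_real_def F_def Q_def)
    qed
  qed
  then show "(\<lambda>i. (\<Sum>M\<in>configs (n i) (N i). \<Sum>x\<in>#M. f x) / (n i * card (configs (n i) (N i))))
           \<longlonglongrightarrow> (1 - lam) * q + lam * mean m"
    by (simp add: \<theta>_def)
qed

end

section \<open>Unlabelled graphs as multisets of components\<close>

text \<open>These sets are the unions of components, described by edges: none leaves S. In this form
  complements are immediate, and graphs can be cut and glued along S.\<close>

definition separated :: "'a graph \<Rightarrow> 'a set \<Rightarrow> bool" where
  "separated G S \<longleftrightarrow> S \<subseteq> verts G \<and> (\<forall>(u, v)\<in>adj G. u \<in> S \<longleftrightarrow> v \<in> S)"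

lemma verts_induced [simp]: "verts (induced G S) = verts G \<inter> S"
  and adj_induced [simp]: "adj (induced G S) = adj G \<inter> S \<times> S"
  by (simp_all add: induced_def)

lemma induced_induced: "induced (induced G S) T = induced G (S \<inter> T)"
  by (auto simp: induced_def)

lemma induced_verts: "simple_graph G \<Longrightarrow> induced G (verts G) = G"
  by (cases G) (auto simp: simple_graph_def induced_def)

lemma separated_compl:
  assumes "simple_graph G" "separated G S"
  shows "separated G (verts G - S)"
  using assms by (fastforce simp: separated_def simple_graph_def)

lemma separated_rtrancl:
  assumes "separated G S" "u \<in> S" "(u, v) \<in> (adj G)\<^sup>*"
  shows "v \<in> S \<and> (u, v) \<in> (adj G \<inter> S \<times> S)\<^sup>*"
  using assms(3)
proof (induction rule: rtrancl_induct)
  case (step w v)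
  then have "v \<in> S" using assms(1) by (auto simp: separated_def)
  then show ?case using step by (auto intro: rtrancl_into_rtrancl)
qed (use assms in auto)

lemma component_verts_induced:
  assumes "separated G S" "v \<in> S"
  shows "component_verts (induced G S) v = component_verts G v"
proof -
  have "(v, w) \<in> (adj G)\<^sup>*" if "(v, w) \<in> (adj G \<inter> S \<times> S)\<^sup>*" for w
    using that rtrancl_mono[of "adj G \<inter> S \<times> S" "adj G"] by blast
  then show ?thesis
    using separated_rtrancl[OF assms] assms by (auto simp: component_verts_def separated_def)
qed

lemma components_induced:
  assumes "separated G S"
  shows "components (induced G S) = component_verts G ` S"
proof -
  have "verts G \<inter> S = S" using assms by (auto simp: separated_def)
  then show ?thesis
    unfolding components_def using component_verts_induced[OF assms] by (auto intro!: image_cong)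
qed

lemma component_verts_eq:
  assumes "simple_graph G" "v \<in> component_verts G u"
  shows "component_verts G v = component_verts G u"
proof -
  have "(v, u) \<in> (adj G)\<^sup>*" "(u, v) \<in> (adj G)\<^sup>*"
    using assms sym_rtrancl[of "adj G"]
    by (auto simp: component_verts_def simple_graph_def dest: symD)
  then show ?thesis by (auto simp: component_verts_def intro: rtrancl_trans)
qed

lemma separated_component:
  assumes "simple_graph G" "S \<in> components G"
  shows "separated G S"
proof -
  obtain r where r: "S = component_verts G r" "r \<in> verts G"
    using assms by (auto simp: components_def)
  have "(u \<in> S) = (v \<in> S)" if "(u, v) \<in> adj G" for u v
  proof -
    have "u \<in> verts G" "v \<in> verts G" "(v, u) \<in> adj G"
      using that assms(1) by (auto simp: simple_graph_def sym_def)
    then show ?thesis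
      using that by (auto simp: r component_verts_def intro: rtrancl_into_rtrancl)
  qed
  then show ?thesis by (auto simp: separated_def r component_verts_def)
qed

lemma component_verts_of_component:
  assumes "simple_graph G" "S \<in> components G" "v \<in> S"
  shows "component_verts G v = S"
proof -
  obtain r where r: "S = component_verts G r" using assms(2) by (auto simp: components_def)
  then show ?thesis using component_verts_eq[OF assms(1), of v r] assms(3) by simp
qed

lemma Union_components: "\<Union> (components G) = verts G"
  by (auto simp: components_def component_verts_def)

lemma components_disjoint:
  assumes "simple_graph G" "S \<in> components G" "T \<in> components G" "S \<noteq> T"
  shows "S \<inter> T = {}"
  using component_verts_of_component[OF assms(1,2)] component_verts_of_component[OF assms(1,3)]
    assms(4) by blast

lemma component_nonempty: "S \<in> components G \<Longrightarrow> S \<noteq> {}"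
  by (auto simp: components_def component_verts_def)

lemma finite_components: "finite (verts G) \<Longrightarrow> finite (components G)"
  by (simp add: components_def)

lemma components_induced_component:
  assumes "simple_graph G" "S \<in> components G"
  shows "components (induced G S) = {S}"
proof -
  have "component_verts G ` S = {S}"
    using component_verts_of_component[OF assms] component_nonempty[OF assms(2)] by auto
  then show ?thesis using components_induced[OF separated_component[OF assms]] by simp
qed

lemma components_connected:
  assumes "connected_graph G"
  shows "components G = {verts G}"
proof -
  have "component_verts G v = verts G" if "v \<in> verts G" for v
    using assms that by (auto simp: component_verts_def connected_graph_def)
  then show ?thesis using assms by (auto simp: components_def connected_graph_def)
qed

text \<open>The counterpart of \<open>ucomponents\<close> for graphs instead of classes. It also
  applies to the empty graph, which represents no \<open>ugraph\<close> but arises when the last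
  component is removed.\<close>

definition component_mset :: "nat graph \<Rightarrow> ugraph multiset" where
  "component_mset G = image_mset (\<lambda>S. abs_ugraph (induced G S)) (mset_set (components G))"

lemma component_mset_split:
  assumes "simple_graph G" "finite (verts G)" "separated G S"
  shows "component_mset G = component_mset (induced G S) + component_mset (induced G (verts G - S))"
proof -
  let ?T = "verts G - S"
  have T: "separated G ?T" by (rule separated_compl[OF assms(1,3)])
  note ind = components_induced[OF assms(3)] components_induced[OF T]
  have S: "S \<subseteq> verts G" using assms by (simp add: separated_def)
  have "S \<union> ?T = verts G" using S by auto
  then have un: "components G = components (induced G S) \<union> components (induced G ?T)"
    by (metis ind image_Un components_def)
  have sub: "U \<subseteq> S \<and> U \<noteq> {}" if "U \<in> components (induced G S)" for U
    using that component_nonempty[OF that] Union_components[of "induced G S"] by auto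
  have sub': "U \<subseteq> ?T" if "U \<in> components (induced G ?T)" for U
    using that Union_components[of "induced G ?T"] by auto
  have "components (induced G S) \<inter> components (induced G ?T) = {}"
    using sub sub' by blast
  then have "mset_set (components G) = mset_set (components (induced G S)) + mset_set (components (induced G ?T))"
    unfolding un using assms(2) by (intro mset_set_Union finite_components) auto
  moreover have "induced (induced G S) U = induced G U" if "U \<in> components (induced G S)" for U
    using sub[OF that] by (simp add: induced_induced Int_absorb1)
  moreover have "induced (induced G ?T) U = induced G U" if "U \<in> components (induced G ?T)" for U
    using sub'[OF that] by (simp add: induced_induced Int_absorb1)
  moreover have "finite (components (induced G S))" "finite (components (induced G ?T))"
    using assms(2) by (auto intro!: finite_components)
  ultimately show ?thesis
    by (auto simp: component_mset_def intro!: arg_cong2[where f = "(+)"] image_mset_cong)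
qed

lemma component_mset_component:
  assumes "simple_graph G" "S \<in> components G"
  shows "component_mset (induced G S) = {#abs_ugraph (induced G S)#}"
  using components_induced_component[OF assms] by (simp add: component_mset_def induced_induced)

lemma component_mset_connected:
  assumes "simple_graph G" "connected_graph G"
  shows "component_mset G = {#abs_ugraph G#}"
  using components_connected[OF assms(2)] induced_verts[OF assms(1)] by (simp add: component_mset_def)

text \<open>No edge crosses the cut in either graph, so adjacency between the two parts is false on
  both sides.\<close>

lemma graph_isomorphism_glue:
  assumes S: "separated G S" and T: "separated H T"
    and f: "graph_isomorphism f (induced G S) (induced H T)"
    and g: "graph_isomorphism g (induced G (verts G - S)) (induced H (verts H - T))"
  shows "graph_isomorphism (\<lambda>v. if v \<in> S then f v else g v) G H"
proof -
  let ?h = "\<lambda>v. if v \<in> S then f v else g v"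
  have sub: "verts G \<inter> S = S" "verts H \<inter> T = T"
    "verts G \<inter> (verts G - S) = verts G - S" "verts H \<inter> (verts H - T) = verts H - T"
    using S T by (auto simp: separated_def)
  have bf: "bij_betw f S T" and bg: "bij_betw g (verts G - S) (verts H - T)"
    using f g by (simp_all add: graph_isomorphism_def sub)
  have "bij_betw ?h S T" using bf by (simp cong: bij_betw_cong)
  moreover have "bij_betw ?h (verts G - S) (verts H - T)"
    using bg by (rule bij_betw_cong[THEN iffD1, rotated]) auto
  ultimately have "bij_betw ?h (S \<union> (verts G - S)) (T \<union> (verts H - T))"
    by (rule bij_betw_combine) auto
  moreover have "S \<union> (verts G - S) = verts G" "T \<union> (verts H - T) = verts H"
    using sub by auto
  ultimately have b: "bij_betw ?h (verts G) (verts H)" by simp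
  have fT: "f v \<in> T" if "v \<in> S" for v using bf that by (auto simp: bij_betw_def)
  have gT: "g v \<in> verts H - T" if "v \<in> verts G - S" for v using bg that by (auto simp: bij_betw_def)
  have "(u, v) \<in> adj G \<longleftrightarrow> (?h u, ?h v) \<in> adj H" if u: "u \<in> verts G" and v: "v \<in> verts G" for u v
  proof -
    consider "u \<in> S" "v \<in> S" | "u \<notin> S" "v \<notin> S" | "(u \<in> S) \<noteq> (v \<in> S)" by blast
    then show ?thesis
    proof cases
      case 1
      then show ?thesis using f fT u v by (auto simp: graph_isomorphism_def)
    next
      case 2
      then show ?thesis using g gT[of u] gT[of v] u v by (auto simp: graph_isomorphism_def)
    next
      case 3
      then have "(u, v) \<notin> adj G" using S by (auto simp: separated_def)
      moreover have "(?h u \<in> T) \<noteq> (?h v \<in> T)" using 3 fT gT[of u] gT[of v] u v by auto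
      then have "(?h u, ?h v) \<notin> adj H" using T by (auto simp: separated_def)
      ultimately show ?thesis by blast
    qed
  qed
  then show ?thesis using b by (auto simp: graph_isomorphism_def)
qed

section \<open>Transfer between graphs and their isomorphism classes\<close>

lemma iso_finite_refl: "iso_finite G G \<longleftrightarrow> finite_graph G"
  using graph_isomorphism_id by (auto simp: iso_finite_def)

lemma ugraph_obtain:
  obtains G where "finite_graph G" "U = abs_ugraph G"
proof
  show "finite_graph (rep_ugraph U)"
    using Quotient_rep_reflp[OF Quotient_ugraph, of U] by (simp add: iso_finite_refl)
  show "U = abs_ugraph (rep_ugraph U)"
    using Quotient_abs_rep[OF Quotient_ugraph, of U] by simp
qed

lemma abs_ugraph_eq_iff:
  assumes "finite_graph G" "finite_graph H"
  shows "abs_ugraph G = abs_ugraph H \<longleftrightarrow> (\<exists>f. graph_isomorphism f G H)"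
  using Quotient_rel[OF Quotient_ugraph, of G H] assms
  by (simp add: iso_finite_refl) (simp add: iso_finite_def)

lemma ucomponents_abs: "finite_graph G \<Longrightarrow> ucomponents (abs_ugraph G) = component_mset G"
  by (simp add: ucomponents.abs_eq iso_finite_refl component_mset_def)

lemma usize_abs: "finite_graph G \<Longrightarrow> usize (abs_ugraph G) = card (verts G)"
  by (simp add: usize.abs_eq iso_finite_refl)

lemma uconnected_abs: "finite_graph G \<Longrightarrow> uconnected (abs_ugraph G) = connected_graph G"
  by (simp add: uconnected.abs_eq iso_finite_refl)

lemma finite_graph_component:
  assumes "simple_graph G" "finite (verts G)" "S \<in> components G"
  shows "finite_graph (induced G S)"
proof -
  have "verts G \<inter> S = S"
    using separated_component[OF assms(1,3)] by (auto simp: separated_def)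
  then show ?thesis
    using assms(2) component_nonempty[OF assms(3)] simple_graph_induced[OF assms(1)]
    unfolding finite_graph_def by (metis finite_Int verts_induced)
qed

lemma component_mset_inj:
  assumes "simple_graph G" "finite (verts G)" "simple_graph H" "finite (verts H)"
    and "component_mset G = component_mset H"
  shows "\<exists>f. graph_isomorphism f G H"
  using assms
proof (induction "component_mset G" arbitrary: G H)
  case empty
  have "verts X = {}" if "{#} = component_mset X" "finite (verts X)" for X
    using that finite_components[of X] Union_components[of X]
    by (auto simp: component_mset_def mset_set_empty_iff)
  then have "verts G = {}" "verts H = {}" using empty by auto
  then show ?case by (auto simp: graph_isomorphism_def)
next
  case (add U M)
  have split: "\<exists>S. separated X S \<and> finite_graph (induced X S) \<and> abs_ugraph (induced X S) = U
      \<and> component_mset (induced X (verts X - S)) = M"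
    if X: "add_mset U M = component_mset X" "simple_graph X" "finite (verts X)" for X
  proof -
    have "U \<in># component_mset X" by (metis X(1) union_single_eq_member)
    then obtain S where S: "S \<in> components X" "abs_ugraph (induced X S) = U"
      using finite_components[OF X(3)] by (auto simp: component_mset_def)
    note sep = separated_component[OF X(2) S(1)]
    have "component_mset (induced X (verts X - S)) = M"
      using component_mset_split[OF X(2,3) sep] component_mset_component[OF X(2) S(1)] S(2) X(1)
      by simp
    then show ?thesis using sep finite_graph_component[OF X(2,3) S(1)] S(2) by blast
  qed
  obtain S where S: "separated G S" "finite_graph (induced G S)" "abs_ugraph (induced G S) = U"
     "component_mset (induced G (verts G - S)) = M"
    using split[of G] add by blast
  obtain T where T: "separated H T" "finite_graph (induced H T)" "abs_ugraph (induced H T) = U"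
     "component_mset (induced H (verts H - T)) = M"
    using split[of H] add by metis
  obtain f where f: "graph_isomorphism f (induced G S) (induced H T)"
    using S T abs_ugraph_eq_iff by metis
  obtain g where g: "graph_isomorphism g (induced G (verts G - S)) (induced H (verts H - T))"
    using add.hyps(1)[of "induced G (verts G - S)" "induced H (verts H - T)"] S(4) T(4) add.prems
    by (auto intro: simple_graph_induced)
  show ?case using graph_isomorphism_glue[OF S(1) T(1) f g] by blast
qed

lemma component_mset_iso:
  assumes "simple_graph G" "finite (verts G)" "simple_graph H" "graph_isomorphism f G H"
  shows "component_mset G = component_mset H"
proof -
  have V: "verts H = f ` verts G" using assms(4) by (auto simp: graph_isomorphism_def bij_betw_def)
  show ?thesis
  proof (cases "verts G = {}")
    case True
    then show ?thesis by (simp add: component_mset_def components_def V)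
  next
    case False
    then have "finite_graph G" "finite_graph H" using assms V by (auto simp: finite_graph_def)
    then show ?thesis using assms(4) abs_ugraph_eq_iff ucomponents_abs by metis
  qed
qed

text \<open>The disjoint union is built inside the natural numbers: the new component is copied to
  even labels, the graph obtained so far to odd ones.\<close>

lemma component_mset_surj:
  assumes "\<And>U. U \<in># M \<Longrightarrow> uconnected U"
  shows "\<exists>G. simple_graph G \<and> finite (verts G) \<and> component_mset G = M"
  using assms
proof (induction M)
  case empty
  show ?case
    by (rule exI[of _ "Graph {} {}"])
      (simp add: simple_graph_def component_mset_def components_def sym_def irrefl_def)
next
  case (add U M)
  obtain G where G: "simple_graph G" "finite (verts G)" "component_mset G = M" using add by auto
  obtain A where A: "finite_graph A" "U = abs_ugraph A" by (rule ugraph_obtain)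
  have A': "simple_graph A" "finite (verts A)" "connected_graph A"
    using A add.prems[of U] uconnected_abs by (auto simp: finite_graph_def)
  define copy where "copy f X = Graph (f ` verts X) (map_prod f f ` adj X)" for f :: "nat \<Rightarrow> nat" and X
  have iso: "graph_isomorphism f X (copy f X)" and simple: "simple_graph (copy f X)"
    if "simple_graph X" "inj f" for f X
  proof -
    have "(u, v) \<in> adj X \<longleftrightarrow> (f u, f v) \<in> map_prod f f ` adj X" for u v
      using that(2) by (auto simp: inj_def)
    then show "graph_isomorphism f X (copy f X)"
      using that(2) by (auto simp: graph_isomorphism_def copy_def bij_betw_def intro: inj_on_subset)
    show "simple_graph (copy f X)"
      unfolding simple_graph_def
    proof (intro conjI)
      show "adj (copy f X) \<subseteq> verts (copy f X) \<times> verts (copy f X)"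
        using that(1) by (auto simp: simple_graph_def copy_def)
      show "sym (adj (copy f X))"
        using that(1) by (auto simp: simple_graph_def copy_def intro!: symI dest: symD)
      show "irrefl (adj (copy f X))"
        using that by (auto simp: simple_graph_def copy_def irrefl_def dest: injD)
    qed
  qed
  let ?d = "\<lambda>v::nat. 2 * v" and ?o = "\<lambda>v::nat. 2 * v + 1"
  let ?A = "copy ?d A" and ?G = "copy ?o G"
  have inj: "inj ?d" "inj ?o" by (auto simp: inj_def)
  have sA: "simple_graph ?A" and sG: "simple_graph ?G"
    using simple A'(1) G(1) inj by blast+
  have disj: "verts ?A \<inter> verts ?G = {}" by (auto simp: copy_def) presburger
  have adjs: "adj ?A \<subseteq> verts ?A \<times> verts ?A" "adj ?G \<subseteq> verts ?G \<times> verts ?G"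
    using sA sG by (auto simp: simple_graph_def)
  define X where "X = Graph (verts ?A \<union> verts ?G) (adj ?A \<union> adj ?G)"
  have X: "simple_graph X"
    using sA sG by (auto simp: X_def simple_graph_def sym_def irrefl_def)
  have fX: "finite (verts X)" using A'(2) G(2) by (simp add: X_def copy_def)
  have sep: "separated X (verts ?A)"
    using disj adjs by (auto simp: separated_def X_def)
  have "induced X (verts ?A) = ?A" "induced X (verts X - verts ?A) = ?G"
    using disj adjs by (intro graph.expand; auto simp: X_def)+
  then have "component_mset X = component_mset ?A + component_mset ?G"
    using component_mset_split[OF X fX sep] by simp
  also have "component_mset ?A = component_mset A"
    using component_mset_iso[OF A'(1,2) sA iso] A'(1) inj by simp
  also have "component_mset A = {#U#}"
    using component_mset_connected[OF A'(1,3)] A by simp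
  also have "component_mset ?G = M"
    using component_mset_iso[OF G(1,2) sG iso] G(1,3) inj by simp
  finally show ?case using X fX by auto
qed

section \<open>Rooting probabilities and connected components\<close>

lemma prob_uniform_rooting_abs:
  assumes "finite_graph G"
  shows "usize (abs_ugraph G) * measure_pmf.prob (uniform_rooting (abs_ugraph G)) A
     = card {v \<in> verts G. abs_rgraph (induced G (component_verts G v), v) \<in> A}"
proof -
  have fin: "finite (verts G)" "verts G \<noteq> {}" using assms by (auto simp: finite_graph_def)
  have "measure_pmf.prob (uniform_rooting (abs_ugraph G)) A =
     measure_pmf.prob (pmf_of_set (verts G))
       ((\<lambda>v. abs_rgraph (induced G (component_verts G v), v)) -` A)"
    using assms by (simp add: uniform_rooting.abs_eq iso_finite_refl)
  also have "\<dots> = card (verts G \<inter> (\<lambda>v. abs_rgraph (induced G (component_verts G v), v)) -` A) / card (verts G)"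
    using fin by (simp add: measure_pmf_of_set)
  also have "verts G \<inter> (\<lambda>v. abs_rgraph (induced G (component_verts G v), v)) -` A
      = {v \<in> verts G. abs_rgraph (induced G (component_verts G v), v) \<in> A}" by auto
  finally show ?thesis using fin usize_abs[OF assms] by simp
qed

text \<open>Multiplied by the number of vertices, a rooting probability counts the vertices whose
  rooted component lies in A. A vertex has the same component in the graph and in its component
  taken alone, so the counts add up.\<close>

lemma prob_uniform_rooting_components:
  "usize U * measure_pmf.prob (uniform_rooting U) A =
     (\<Sum>H\<in>#ucomponents U. usize H * measure_pmf.prob (uniform_rooting H) A)"
proof -
  obtain G where G: "finite_graph G" "U = abs_ugraph G" by (rule ugraph_obtain)
  have sG: "simple_graph G" "finite (verts G)" using G by (auto simp: finite_graph_def)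
  let ?Q = "\<lambda>v. abs_rgraph (induced G (component_verts G v), v) \<in> A"
  have "usize (abs_ugraph (induced G S)) *
      measure_pmf.prob (uniform_rooting (abs_ugraph (induced G S))) A = card {v \<in> S. ?Q v}"
    if S: "S \<in> components G" for S
  proof -
    have sep: "separated G S" by (rule separated_component[OF sG(1) S])
    then have "verts G \<inter> S = S" by (auto simp: separated_def)
    moreover have "induced (induced G S) (component_verts (induced G S) v) = induced G (component_verts G v)"
      if "v \<in> S" for v
      using component_verts_induced[OF sep that] component_verts_of_component[OF sG(1) S that]
      by (simp add: induced_induced)
    ultimately show ?thesis
      unfolding prob_uniform_rooting_abs[OF finite_graph_component[OF sG S]]
      by (intro arg_cong[where f = "\<lambda>X. real (card X)"]) auto
  qed
  then have "(\<Sum>H\<in>#ucomponents U. usize H * measure_pmf.prob (uniform_rooting H) A)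
      = (\<Sum>S\<in>components G. real (card {v \<in> S. ?Q v}))"
    unfolding G(2) ucomponents_abs[OF G(1)] component_mset_def
    by (simp add: multiset.map_comp comp_def sum_unfold_sum_mset[symmetric])
  also have "\<dots> = real (card (\<Union>S\<in>components G. {v \<in> S. ?Q v}))"
  proof -
    have "finite S" if "S \<in> components G" for S
      using that sG(2) Union_components[of G] by (auto intro: finite_subset)
    then show ?thesis
      using components_disjoint[OF sG(1)] finite_components[OF sG(2)]
      by (subst card_UN_disjoint) fastforce+
  qed
  also have "(\<Union>S\<in>components G. {v \<in> S. ?Q v}) = {v \<in> verts G. ?Q v}"
    using Union_components[of G] by blast
  finally show ?thesis unfolding G(2) prob_uniform_rooting_abs[OF G(1)] by simp
qed

text \<open>This is the preceding identity for the full event, where all probabilities are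
  1.\<close>

lemma usize_eq_sum_components: "usize U = (\<Sum>H\<in>#ucomponents U. usize H)"
proof -
  have "real (usize U) = (\<Sum>H\<in>#ucomponents U. real (usize H))"
    using prob_uniform_rooting_components[of U UNIV] by simp
  also have "\<dots> = real (\<Sum>H\<in>#ucomponents U. usize H)"
    by (simp add: of_nat_sum_mset multiset.map_comp comp_def)
  finally show ?thesis by (rule of_nat_eq_iff[THEN iffD1])
qed

text \<open>Every class has a representative on the vertex set \<open>{..<n}\<close>, which carries
  finitely many edge sets.\<close>

lemma finite_ugraphs_of_size: "finite {U. usize U = n}"
proof (rule finite_subset)
  show "{U. usize U = n} \<subseteq> abs_ugraph ` Graph {..<n} ` Pow ({..<n} \<times> {..<n})"
  proof
    fix U assume U: "U \<in> {U. usize U = n}"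
    obtain G where G: "finite_graph G" "U = abs_ugraph G" by (rule ugraph_obtain)
    have "card (verts G) = n" using U G usize_abs by simp
    then obtain f where f: "bij_betw f (verts G) {..<n}"
      using G(1) by (metis card_lessThan finite_graph_def finite_lessThan finite_same_card_bij)
    define H where "H = Graph {..<n} (map_prod f f ` adj G)"
    have V: "adj G \<subseteq> verts G \<times> verts G" "sym (adj G)" "irrefl (adj G)"
      using G by (auto simp: finite_graph_def simple_graph_def)
    have fV: "f v < n" if "v \<in> verts G" for v using f that by (auto simp: bij_betw_def)
    have inj: "inj_on f (verts G)" using f by (auto simp: bij_betw_def)
    have E: "(u, v) \<in> adj G \<longleftrightarrow> (f u, f v) \<in> map_prod f f ` adj G"
      if "u \<in> verts G" "v \<in> verts G" for u v
      using that V(1) inj by (auto dest: inj_onD)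
    have sub: "map_prod f f ` adj G \<subseteq> {..<n} \<times> {..<n}" using V fV by auto
    have "simple_graph H"
      unfolding simple_graph_def
    proof (intro conjI)
      show "adj H \<subseteq> verts H \<times> verts H" using sub by (simp add: H_def)
      show "sym (adj H)" using V(2) by (force simp: H_def sym_def)
      show "irrefl (adj H)" using V(1,3) inj by (auto simp: H_def irrefl_def dest: inj_onD)
    qed
    moreover have "verts H \<noteq> {}"
      using G(1) fV by (auto simp: H_def finite_graph_def)
    ultimately have "finite_graph H" by (simp add: finite_graph_def H_def)
    moreover have "graph_isomorphism f G H"
      using f E by (simp add: graph_isomorphism_def H_def)
    ultimately have "U = abs_ugraph H" using G abs_ugraph_eq_iff by metis
    then show "U \<in> abs_ugraph ` Graph {..<n} ` Pow ({..<n} \<times> {..<n})"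
      using sub by (auto simp: H_def)
  qed
qed simp

text \<open>It turns a uniform graph with N components into a uniform multiset. Connectedness makes
  every multiset realisable, and \<open>0 < N\<close> excludes the empty multiset, which belongs to
  no \<open>ugraph\<close>.\<close>

lemma bij_betw_ucomponents:
  assumes con: "\<forall>U\<in>\<C>. uconnected U" and N: "0 < N"
  shows "bij_betw ucomponents (with_components \<C> n N)
     {M. set_mset M \<subseteq> \<C> \<and> size M = N \<and> (\<Sum>H\<in>#M. usize H) = n}"
proof (rule bij_betw_imageI)
  show "inj_on ucomponents (with_components \<C> n N)"
  proof (rule inj_onI)
    fix U V assume eq: "ucomponents U = ucomponents V"
    obtain G where G: "finite_graph G" "U = abs_ugraph G" by (rule ugraph_obtain)
    obtain H where H: "finite_graph H" "V = abs_ugraph H" by (rule ugraph_obtain)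
    have "\<exists>f. graph_isomorphism f G H"
      using G H eq ucomponents_abs by (intro component_mset_inj) (auto simp: finite_graph_def)
    then show "U = V" using G H abs_ugraph_eq_iff by simp
  qed
  show "ucomponents ` with_components \<C> n N =
      {M. set_mset M \<subseteq> \<C> \<and> size M = N \<and> (\<Sum>H\<in>#M. usize H) = n}"
  proof (intro equalityI subsetI)
    fix M assume M: "M \<in> {M. set_mset M \<subseteq> \<C> \<and> size M = N \<and> (\<Sum>H\<in>#M. usize H) = n}"
    then obtain G where G: "simple_graph G" "finite (verts G)" "component_mset G = M"
      using component_mset_surj[of M] con by auto
    have "verts G \<noteq> {}" using G(3) M N by (auto simp: component_mset_def components_def)
    then have "finite_graph G" using G by (simp add: finite_graph_def)
    then have "ucomponents (abs_ugraph G) = M" using ucomponents_abs G by simp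
    then show "M \<in> ucomponents ` with_components \<C> n N"
      using M usize_eq_sum_components[of "abs_ugraph G"] by (intro image_eqI[of _ _ "abs_ugraph G"]) (auto simp: with_components_def)
  next
    fix M assume "M \<in> ucomponents ` with_components \<C> n N"
    then obtain U where U: "M = ucomponents U" "U \<in> with_components \<C> n N" by blast
    then show "M \<in> {M. set_mset M \<subseteq> \<C> \<and> size M = N \<and> (\<Sum>H\<in>#M. usize H) = n}"
      using usize_eq_sum_components[of U] by (simp add: with_components_def)
  qed
qed

section \<open>Rooted graphs and mixtures\<close>

lemma prob_random_rooted:
  assumes "finite S" "S \<noteq> {}"
  shows "measure_pmf.prob (random_rooted S) A = (\<Sum>U\<in>S. measure_pmf.prob (uniform_rooting U) A) / card S"
proof -
  let ?p = "\<lambda>U. measure_pmf.prob (uniform_rooting U) A"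
  have "emeasure (random_rooted S) A = (\<integral>\<^sup>+U. ennreal (?p U) \<partial>pmf_of_set S)"
    unfolding random_rooted_def emeasure_bind_pmf by (simp add: measure_pmf.emeasure_eq_measure)
  also have "\<dots> = ennreal (\<integral>U. ?p U \<partial>pmf_of_set S)"
    using assms by (intro nn_integral_eq_integral integrable_measure_pmf_finite) auto
  finally have "measure_pmf.prob (random_rooted S) A = (\<integral>U. ?p U \<partial>pmf_of_set S)"
    by (simp add: measure_pmf.emeasure_eq_measure integral_nonneg_AE)
  then show ?thesis using assms by (simp add: integral_pmf_of_set)
qed

lemma measurable_mixture_kernel:
  assumes "\<mu> \<in> space (prob_algebra M)" "\<nu> \<in> space (prob_algebra M)"
  shows "(\<lambda>b. if b then \<nu> else \<mu>) \<in> measure_pmf (bernoulli_pmf p) \<rightarrow>\<^sub>M prob_algebra M"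
  using assms by simp

lemma mixture_in_prob_algebra:
  assumes "\<mu> \<in> space (prob_algebra M)" "\<nu> \<in> space (prob_algebra M)"
  shows "mixture p \<mu> \<nu> \<in> space (prob_algebra M)"
proof -
  have b: "measure_pmf (bernoulli_pmf p) \<in> space (prob_algebra (measure_pmf (bernoulli_pmf p)))"
    by (simp add: space_prob_algebra measure_pmf.prob_space_axioms)
  show ?thesis
    unfolding mixture_def space_prob_algebra mem_Collect_eq
    using prob_space_bind'[OF b measurable_mixture_kernel[OF assms]]
      sets_bind'[OF b measurable_mixture_kernel[OF assms]] by simp
qed

text \<open>The value \<open>True\<close> of the Bernoulli variable selects \<nu>, which therefore
  has weight p.\<close>

lemma emeasure_mixture:
  assumes "\<mu> \<in> space (prob_algebra M)" "\<nu> \<in> space (prob_algebra M)"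
    and "0 \<le> p" "p \<le> 1" "X \<in> sets M"
  shows "emeasure (mixture p \<mu> \<nu>) X = emeasure \<nu> X * p + emeasure \<mu> X * (1 - p)"
proof -
  have "emeasure (mixture p \<mu> \<nu>) X =
      (\<integral>\<^sup>+b. emeasure (if b then \<nu> else \<mu>) X \<partial>measure_pmf (bernoulli_pmf p))"
    unfolding mixture_def
    using measurable_prob_algebraD[OF measurable_mixture_kernel[OF assms(1,2)]] assms(5)
    by (intro emeasure_bind) auto
  then show ?thesis using assms(3,4) by simp
qed

lemma measure_mixture:
  assumes "\<mu> \<in> space (prob_algebra M)" "\<nu> \<in> space (prob_algebra M)"
    and "0 \<le> p" "p \<le> 1" "X \<in> sets M"
  shows "measure (mixture p \<mu> \<nu>) X = (1 - p) * measure \<mu> X + p * measure \<nu> X"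
proof -
  interpret \<mu>: prob_space \<mu> using assms by (simp add: space_prob_algebra)
  interpret \<nu>: prob_space \<nu> using assms by (simp add: space_prob_algebra)
  have "emeasure (mixture p \<mu> \<nu>) X = ennreal ((1 - p) * measure \<mu> X + p * measure \<nu> X)"
    unfolding emeasure_mixture[OF assms] \<mu>.emeasure_eq_measure \<nu>.emeasure_eq_measure
    using assms by (simp add: ennreal_mult'[symmetric] ennreal_plus[symmetric] add.commute mult.commute
        del: ennreal_plus)
  then show ?thesis
    using assms by (intro measure_eq_emeasure_eq_ennreal) auto
qed

lemma ball_fibre_in_sets: "{g. rball k g = b} \<in> sets rgraph_space"
  unfolding rgraph_space_def by (rule in_measure_of) auto

lemma rgraph_law_in_prob_algebra: "rgraph_law p \<in> space (prob_algebra rgraph_space)"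
  unfolding rgraph_law_def space_prob_algebra
  by (auto intro!: measure_pmf.prob_space_distr simp: rgraph_space_def)

lemma measure_rgraph_law:
  "measure (rgraph_law p) {g. rball k g = b} = measure_pmf.prob p {g. rball k g = b}"
  unfolding rgraph_law_def
  by (subst measure_distr) (auto simp: ball_fibre_in_sets rgraph_space_def)

lemma of_size_eq: "{U \<in> \<C>. usize U = k} = of_size \<C> k"
  by (simp add: of_size_def)

lemma finite_of_size: "finite (of_size \<C> k)"
  by (rule finite_subset[OF _ finite_ugraphs_of_size[of k]]) (auto simp: of_size_def)

text \<open>With f U the number of vertices of U whose rooted component lies in A,
  \<open>mean k\<close> is the rooting probability in size k, and the average of f over
  configurations divided by n is the one for graphs with N components. Convergence for this single A
  is all that is assumed about it.\<close>

lemma rooting_probability_limit: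
  fixes A :: "rgraph set"
  assumes con: "\<forall>G\<in>\<C>. uconnected G"
    and sub: "subexponential (\<lambda>k. real (card (of_size \<C> k))) \<rho>"
    and m: "m = (LEAST k. 1 \<le> k \<and> 0 < card (of_size \<C> k))"
    and lam: "0 \<le> lam" "lam < 1"
    and n: "filterlim n at_top sequentially" and N: "filterlim N at_top sequentially"
    and ratio: "(\<lambda>i. real m * real (N i) / real (n i)) \<longlonglongrightarrow> lam"
    and lim: "(\<lambda>k. measure_pmf.prob (random_rooted (of_size \<C> k)) A) \<longlonglongrightarrow> q"
  shows "(\<lambda>i. measure_pmf.prob (random_rooted (with_components \<C> (n i) (N i))) A)
     \<longlonglongrightarrow> (1 - lam) * q + lam * measure_pmf.prob (random_rooted (of_size \<C> m)) A"
proof -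
  define f where "f U = usize U * measure_pmf.prob (uniform_rooting U) A" for U
  have pos: "\<forall>\<^sub>F k in sequentially. 0 < card (of_size \<C> k)"
    using sub by (simp add: subexponential_def)
  then have "\<forall>\<^sub>F k in sequentially. 1 \<le> k \<and> 0 < card (of_size \<C> k)"
    using eventually_ge_at_top[of 1] by eventually_elim auto
  then have "\<exists>k. 1 \<le> k \<and> 0 < card (of_size \<C> k)"
    unfolding eventually_sequentially by blast
  then have m1: "1 \<le> m \<and> 0 < card (of_size \<C> m)"
    unfolding m by (rule LeastI_ex)
  interpret component_statistic \<C> usize m f
  proof
    show "finite {U \<in> \<C>. usize U = k}" for k by (simp add: of_size_eq finite_of_size)
    show "{U \<in> \<C>. usize U = m} \<noteq> {}" using m1 by (auto simp: of_size_eq)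
    show "0 < m" using m1 by simp
    show "0 \<le> f U" for U by (simp add: f_def)
    show "f U \<le> usize U" for U by (simp add: f_def mult_left_le)
    fix U assume "U \<in> \<C>"
    obtain G where G: "finite_graph G" "U = abs_ugraph G" by (rule ugraph_obtain)
    \<comment> \<open>Unlabelled graphs are nonempty, so the size of every member competes in the
      minimum that defines m.\<close>
    have "1 \<le> usize U"
      using G usize_abs by (simp add: finite_graph_def Suc_le_eq card_gt_0_iff)
    moreover have "0 < card (of_size \<C> (usize U))"
      using \<open>U \<in> \<C>\<close> finite_of_size by (auto simp: card_gt_0_iff of_size_def)
    ultimately show "m \<le> usize U" unfolding m by (intro Least_le) auto
  qed
  have mean_eq: "mean k = measure_pmf.prob (random_rooted (of_size \<C> k)) A"
    if "0 < k" "0 < card (of_size \<C> k)" for k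
  proof -
    have "(\<Sum>U\<in>of_size \<C> k. f U) = k * (\<Sum>U\<in>of_size \<C> k. measure_pmf.prob (uniform_rooting U) A)"
      unfolding sum_distrib_left by (intro sum.cong) (auto simp: f_def of_size_def)
    moreover have "of_size \<C> k \<noteq> {}" using that by auto
    ultimately show ?thesis
      using that by (simp add: mean_def of_size_eq prob_random_rooted finite_of_size)
  qed
  have "\<forall>\<^sub>F k in sequentially. measure_pmf.prob (random_rooted (of_size \<C> k)) A = mean k"
    using pos eventually_gt_at_top[of 0] by eventually_elim (simp add: mean_eq)
  then have q: "mean \<longlonglongrightarrow> q" using lim by (rule Lim_transform_eventually[rotated])
  note lims = mean_limit[OF sub[folded of_size_eq] q lam n N ratio]
  have "\<forall>\<^sub>F i in sequentially.
      (\<Sum>M\<in>configs (n i) (N i). \<Sum>U\<in>#M. f U) / (n i * card (configs (n i) (N i)))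
      = measure_pmf.prob (random_rooted (with_components \<C> (n i) (N i))) A"
    using lims(1) filterlim_at_top[THEN iffD1, OF N, rule_format, of 1]
      filterlim_at_top[THEN iffD1, OF n, rule_format, of 1]
  proof eventually_elim
    case (elim i)
    let ?G = "with_components \<C> (n i) (N i)"
    have bij: "bij_betw ucomponents ?G (configs (n i) (N i))"
      unfolding configs_def using elim
      by (intro bij_betw_ucomponents con) auto
    have fin: "finite ?G"
      by (rule finite_subset[OF _ finite_ugraphs_of_size[of "n i"]]) (auto simp: with_components_def)
    have card: "card ?G = card (configs (n i) (N i))" by (rule bij_betw_same_card[OF bij])
    then have ne: "?G \<noteq> {}" using elim by auto
    have "(\<Sum>M\<in>configs (n i) (N i). \<Sum>U\<in>#M. f U) = (\<Sum>G\<in>?G. \<Sum>U\<in>#ucomponents G. f U)"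
      by (rule sum.reindex_bij_betw[OF bij, symmetric])
    also have "\<dots> = (\<Sum>G\<in>?G. n i * measure_pmf.prob (uniform_rooting G) A)"
    proof (rule sum.cong[OF refl])
      fix G assume "G \<in> ?G"
      then have "usize G = n i" by (simp add: with_components_def)
      then show "(\<Sum>U\<in>#ucomponents G. f U) = n i * measure_pmf.prob (uniform_rooting G) A"
        using prob_uniform_rooting_components[of G A] by (simp add: f_def)
    qed
    also have "\<dots> = n i * (\<Sum>G\<in>?G. measure_pmf.prob (uniform_rooting G) A)"
      by (simp add: sum_distrib_left)
    finally show ?case
      using elim by (simp add: prob_random_rooted[OF fin ne] card)
  qed
  then have "(\<lambda>i. measure_pmf.prob (random_rooted (with_components \<C> (n i) (N i))) A)
     \<longlonglongrightarrow> (1 - lam) * q + lam * mean m"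
    using lims(2) by (rule Lim_transform_eventually[rotated])
  then show ?thesis using mean_eq[of m] m1 by simp
qed

theorem proposition1p4:
  fixes \<C> :: "ugraph set" and \<rho> lam :: real and m :: nat
    and n N :: "nat \<Rightarrow> nat" and \<mu> :: "rgraph measure"
  assumes "\<forall>G\<in>\<C>. uconnected G"
    and "subexponential (\<lambda>k. real (card (of_size \<C> k))) \<rho>"
    and "m = (LEAST k. 1 \<le> k \<and> 0 < card (of_size \<C> k))"
    and "0 \<le> lam" and "lam < 1"
    and "filterlim n at_top sequentially" and "filterlim N at_top sequentially"
    and "(\<lambda>i. real m * real (N i) / real (n i)) \<longlonglongrightarrow> lam"
    and "BS_converges (\<lambda>k. random_rooted (of_size \<C> k)) \<mu>"
  shows "BS_converges (\<lambda>i. random_rooted (with_components \<C> (n i) (N i)))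
           (mixture lam \<mu> (rgraph_law (random_rooted (of_size \<C> m)))) \<and>
         ((\<lambda>i. real (N i)) \<in> o(\<lambda>i. real (n i)) \<longrightarrow>
           mixture lam \<mu> (rgraph_law (random_rooted (of_size \<C> m))) = \<mu>)"
proof (intro conjI impI)
  let ?\<nu> = "rgraph_law (random_rooted (of_size \<C> m))"
  have lim: "(\<lambda>k. measure_pmf.prob (random_rooted (of_size \<C> k)) {g. rball j g = b})
                  \<longlonglongrightarrow> measure \<mu> {g. rball j g = b}" if "1 \<le> j" for j b
    using assms(9) that by (auto simp: BS_converges_def)
  have \<mu>: "\<mu> \<in> space (prob_algebra rgraph_space)"
    using assms(9) by (simp add: BS_converges_def)
  note \<nu> = rgraph_law_in_prob_algebra[of "random_rooted (of_size \<C> m)"]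
  show "BS_converges (\<lambda>i. random_rooted (with_components \<C> (n i) (N i))) (mixture lam \<mu> ?\<nu>)"
    unfolding BS_converges_def
  proof (intro conjI allI impI)
    show "mixture lam \<mu> ?\<nu> \<in> space (prob_algebra rgraph_space)"
      by (rule mixture_in_prob_algebra[OF \<mu> \<nu>])
    fix j :: nat and b assume "1 \<le> j"
    have "measure (mixture lam \<mu> ?\<nu>) {g. rball j g = b} = (1 - lam) * measure \<mu> {g. rball j g = b}
        + lam * measure_pmf.prob (random_rooted (of_size \<C> m)) {g. rball j g = b}"
      using measure_mixture[OF \<mu> \<nu> assms(4) _ ball_fibre_in_sets] assms(5)
      by (simp add: measure_rgraph_law)
    then show "(\<lambda>i. measure_pmf.prob (random_rooted (with_components \<C> (n i) (N i))) {g. rball j g = b})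
        \<longlonglongrightarrow> measure (mixture lam \<mu> ?\<nu>) {g. rball j g = b}"
      using rooting_probability_limit[OF assms(1-8) lim[OF \<open>1 \<le> j\<close>]] by simp
  qed
  assume "(\<lambda>i. real (N i)) \<in> o(\<lambda>i. real (n i))"
  then have "(\<lambda>i. real (N i) / real (n i)) \<longlonglongrightarrow> 0" by (rule smalloD_tendsto)
  then have "(\<lambda>i. real m * (real (N i) / real (n i))) \<longlonglongrightarrow> 0" by (rule tendsto_mult_right_zero)
  \<comment> \<open>If N = o(n), then m * N / n tends to 0 as well as to lam.\<close>
  then have "lam = 0" using assms(8) LIMSEQ_unique by fastforce
  show "mixture lam \<mu> ?\<nu> = \<mu>"
  \<comment> \<open>Equality in law concerns all measurable sets, so the mixture formula is applied
    to an arbitrary \<open>X\<close> and not just to ball events.\<close>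
  proof (rule measure_eqI)
    show "sets (mixture lam \<mu> ?\<nu>) = sets \<mu>"
      using mixture_in_prob_algebra[OF \<mu> \<nu>] \<mu> by (simp add: space_prob_algebra)
    fix X assume "X \<in> sets (mixture lam \<mu> ?\<nu>)"
    then have "X \<in> sets rgraph_space"
      using mixture_in_prob_algebra[OF \<mu> \<nu>] by (simp add: space_prob_algebra)
    then show "emeasure (mixture lam \<mu> ?\<nu>) X = emeasure \<mu> X"
      using emeasure_mixture[OF \<mu> \<nu>] \<open>lam = 0\<close> by simp
  qed
qed

end
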